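(* Let $I\subset\mathbb R$ be a compact interval, $\mu\ge 0$, and let $H(t)$, $t\in I$, be a family of symmetric operators on $\mathcal H$ such that the equation $\mathrm i\partial_t u(t)=H(t)u(t)$ generates a unitary propagator $U(t,s):\mathcal H\to\mathcal H$, $s,t\in I$, i.e. unitary operators, strongly continuous in $(t,s)$, with $U(t,r)U(r,s)=U(t,s)$ and $U(s,s)=\mathbf 1$. Assume: (i) for every $t\in I$, $H(t)$ extends to a bounded operator $\mathcal H^\mu\to\mathcal H$; (ii) $t\mapsto H(t)$ is continuous from $I$ to $\mathcal L(\mathcal H^\mu,\mathcal H)$ (operator norm); (iii) $U(t,s)$ preserves $\mathcal H^\mu$, and for every $u\in\mathcal H^\mu$ the map $(t,s)\mapsto U(t,s)u$ is continuous from $I\times I$ to $\mathcal H^\mu$; (iv) for every $u\in\mathcal H^\mu$, $t\mapsto U(t,s)u$ is a strong solution of $\mathrm i\partial_t u(t)=H(t)u(t)$ with values in $\mathcal H$. Then for every $u\in\mathcal H^\mu$, $$\sup_{(t,s)\in I\times I}\|U_N(t,s)P_Nu-U(t,s)u\|\longrightarrow 0\qquad (N\to\infty).$$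
   Context: $\mathcal H$ is a complex separable Hilbert space and $H_0$ a positive self-adjoint operator on $\mathcal H$ with compact resolvent (spectrum contained in $[0,\infty)$). For $N>0$, $P_N=\mathbf 1_{[0,N]}(H_0)$ is the spectral projection and $\mathcal H_N=P_N\mathcal H$, which is finite-dimensional. For $r\ge0$, $\mathcal H^r=D((1+H_0)^r)$ with norm $\|u\|_r=\|(1+H_0)^ru\|$, and $\mathcal H^0=\mathcal H$. $H_N(t)=P_NH(t)P_N$ is viewed as a self-adjoint operator on $\mathcal H_N$, and $U_N(t,s):\mathcal H_N\to\mathcal H_N$ is the unitary propagator determined by $\mathrm i\partial_tU_N(t,s)=H_N(t)U_N(t,s)$, $U_N(s,s)=\mathbf 1_{\mathcal H_N}$. *)

theory Defs
  imports "HOL-Analysis.Analysis"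
begin

section \<open>Complex Hilbert spaces\<close>

text \<open>The inner product is antilinear in the first argument. The real structure, topology and
  norm are those of the underlying real normed space.\<close>

class complex_hilbert = real_normed_vector + complete_space +
  fixes scaleC :: "complex \<Rightarrow> 'a \<Rightarrow> 'a" (infixr "*\<^sub>C" 75)
    and cinner :: "'a \<Rightarrow> 'a \<Rightarrow> complex"
  assumes scaleC_add_right: "c *\<^sub>C (x + y) = c *\<^sub>C x + c *\<^sub>C y"
    and scaleC_add_left: "(c + d) *\<^sub>C x = c *\<^sub>C x + d *\<^sub>C x"
    and scaleC_scaleC: "c *\<^sub>C (d *\<^sub>C x) = (c * d) *\<^sub>C x"
    and scaleC_of_real: "complex_of_real r *\<^sub>C x = r *\<^sub>R x"
    and cinner_commute: "cinner x y = cnj (cinner y x)"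
    and cinner_add_right: "cinner x (y + z) = cinner x y + cinner x z"
    and cinner_scaleC_right: "cinner x (c *\<^sub>C y) = c * cinner x y"
    and cinner_self: "cinner x x = complex_of_real ((norm x)\<^sup>2)"

instantiation complex :: complex_hilbert
begin
definition scaleC_complex :: "complex \<Rightarrow> complex \<Rightarrow> complex" where "scaleC_complex c x = c * x"
definition cinner_complex :: "complex \<Rightarrow> complex \<Rightarrow> complex" where "cinner_complex x y = cnj x * y"
instance
proof
  fix c d x y z :: complex and r :: real
  show "c *\<^sub>C (x + y) = c *\<^sub>C x + c *\<^sub>C y" "(c + d) *\<^sub>C x = c *\<^sub>C x + d *\<^sub>C x"
    "c *\<^sub>C (d *\<^sub>C x) = (c * d) *\<^sub>C x"
    by (simp_all add: scaleC_complex_def distrib_left distrib_right)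
  show "complex_of_real r *\<^sub>C x = r *\<^sub>R x"
    by (simp add: scaleC_complex_def scaleR_conv_of_real)
  show "cinner x y = cnj (cinner y x)" "cinner x (y + z) = cinner x y + cinner x z"
    "cinner x (c *\<^sub>C y) = c * cinner x y"
    by (simp_all add: cinner_complex_def scaleC_complex_def distrib_left)
  show "cinner x x = complex_of_real ((norm x)\<^sup>2)"
    unfolding cinner_complex_def complex_norm_square by (rule mult.commute)
qed
end

definition csubspace :: "'a::complex_hilbert set \<Rightarrow> bool" where
  "csubspace S \<longleftrightarrow> 0 \<in> S \<and> (\<forall>x\<in>S. \<forall>y\<in>S. x + y \<in> S) \<and> (\<forall>c. \<forall>x\<in>S. c *\<^sub>C x \<in> S)"

definition clinear_on :: "'a::complex_hilbert set \<Rightarrow> ('a \<Rightarrow> 'a) \<Rightarrow> bool" where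
  "clinear_on S T \<longleftrightarrow>
     (\<forall>x\<in>S. \<forall>y\<in>S. T (x + y) = T x + T y) \<and> (\<forall>c. \<forall>x\<in>S. T (c *\<^sub>C x) = c *\<^sub>C T x)"

definition unitary_op :: "('a::complex_hilbert \<Rightarrow> 'a) \<Rightarrow> bool" where
  "unitary_op T \<longleftrightarrow> clinear_on UNIV T \<and> surj T \<and> (\<forall>x y. cinner (T x) (T y) = cinner x y)"

section \<open>Unbounded operators\<close>

text \<open>An unbounded operator is a domain \<open>D\<close> together with a function \<open>A\<close> whose values outside
  \<open>D\<close> are irrelevant.\<close>

definition densely_defined_op :: "'a::complex_hilbert set \<Rightarrow> ('a \<Rightarrow> 'a) \<Rightarrow> bool" where
  "densely_defined_op D A \<longleftrightarrow> csubspace D \<and> closure D = UNIV \<and> clinear_on D A"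

definition symmetric_op :: "'a::complex_hilbert set \<Rightarrow> ('a \<Rightarrow> 'a) \<Rightarrow> bool" where
  "symmetric_op D A \<longleftrightarrow>
     densely_defined_op D A \<and> (\<forall>u\<in>D. \<forall>v\<in>D. cinner (A u) v = cinner u (A v))"

text \<open>The left-hand side of the inner equivalence says that \<open>(v, w)\<close> lies in the graph of the
  adjoint.\<close>

definition selfadjoint_op :: "'a::complex_hilbert set \<Rightarrow> ('a \<Rightarrow> 'a) \<Rightarrow> bool" where
  "selfadjoint_op D A \<longleftrightarrow> densely_defined_op D A \<and>
     (\<forall>v w. (\<forall>u\<in>D. cinner v (A u) = cinner w u) \<longleftrightarrow> v \<in> D \<and> w = A v)"

definition resolvent_set :: "'a::complex_hilbert set \<Rightarrow> ('a \<Rightarrow> 'a) \<Rightarrow> complex set" where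
  "resolvent_set D A = {z. bij_betw (\<lambda>u. A u - z *\<^sub>C u) D UNIV \<and>
     (\<exists>C. \<forall>u\<in>D. norm u \<le> C * norm (A u - z *\<^sub>C u))}"

definition spectrum :: "'a::complex_hilbert set \<Rightarrow> ('a \<Rightarrow> 'a) \<Rightarrow> complex set" where
  "spectrum D A = - resolvent_set D A"

definition resolvent :: "'a::complex_hilbert set \<Rightarrow> ('a \<Rightarrow> 'a) \<Rightarrow> complex \<Rightarrow> 'a \<Rightarrow> 'a" where
  "resolvent D A z = the_inv_into D (\<lambda>u. A u - z *\<^sub>C u)"

definition compact_resolvent :: "'a::complex_hilbert set \<Rightarrow> ('a \<Rightarrow> 'a) \<Rightarrow> bool" where
  "compact_resolvent D A \<longleftrightarrow> (\<exists>z\<in>resolvent_set D A.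
     \<forall>S. bounded S \<longrightarrow> compact (closure (resolvent D A z ` S)))"

definition positive_op_compact_resolvent :: "'a::complex_hilbert set \<Rightarrow> ('a \<Rightarrow> 'a) \<Rightarrow> bool" where
  "positive_op_compact_resolvent D A \<longleftrightarrow> selfadjoint_op D A \<and>
     spectrum D A \<subseteq> complex_of_real ` {0..} \<and> compact_resolvent D A"

section \<open>Functional calculus for self-adjoint operators with compact resolvent\<close>

text \<open>The spectrum of a self-adjoint operator \<open>A\<close> with compact resolvent consists of real
  eigenvalues, so its spectral measure is the sum of the projections \<open>\<Pi>\<close> onto the
  eigenspaces, and \<open>f(A) u\<close> is the sum over the eigenvalues \<open>l\<close> of \<open>f l *\<^sub>R \<Pi> u\<close>. The domain is
  the set of those \<open>u\<close> for which \<open>f\<close> is square integrable against the spectral measure of \<open>u\<close>.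
  These definitions are meaningful only for such operators.\<close>

definition eigenspace :: "'a::complex_hilbert set \<Rightarrow> ('a \<Rightarrow> 'a) \<Rightarrow> real \<Rightarrow> 'a set" where
  "eigenspace D A l = {u \<in> D. A u = l *\<^sub>R u}"

definition eigenvalues :: "'a::complex_hilbert set \<Rightarrow> ('a \<Rightarrow> 'a) \<Rightarrow> real set" where
  "eigenvalues D A = {l. \<exists>u\<in>eigenspace D A l. u \<noteq> 0}"

definition orth_proj :: "'a::complex_hilbert set \<Rightarrow> 'a \<Rightarrow> 'a" where
  "orth_proj M u = (THE p. p \<in> M \<and> (\<forall>m\<in>M. cinner m (u - p) = 0))"

definition spectral_dom ::
    "'a::complex_hilbert set \<Rightarrow> ('a \<Rightarrow> 'a) \<Rightarrow> (real \<Rightarrow> real) \<Rightarrow> 'a set" where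
  "spectral_dom D A f =
     {u. (\<lambda>l. (f l)\<^sup>2 * (norm (orth_proj (eigenspace D A l) u))\<^sup>2) summable_on eigenvalues D A}"

definition spectral_fun ::
    "'a::complex_hilbert set \<Rightarrow> ('a \<Rightarrow> 'a) \<Rightarrow> (real \<Rightarrow> real) \<Rightarrow> 'a \<Rightarrow> 'a" where
  "spectral_fun D A f u =
     (\<Sum>\<^sub>\<infinity>l\<in>eigenvalues D A. f l *\<^sub>R orth_proj (eigenspace D A l) u)"

definition spectral_proj :: "'a::complex_hilbert set \<Rightarrow> ('a \<Rightarrow> 'a) \<Rightarrow> real \<Rightarrow> 'a \<Rightarrow> 'a" where
  "spectral_proj D A N = spectral_fun D A (indicator {0..N})"

text \<open>The scale \<open>D((1 + A)\<^sup>r)\<close> with norm \<open>\<parallel>(1 + A)\<^sup>r u\<parallel>\<close>, for \<open>A \<ge> 0\<close>.\<close>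

definition scale_space :: "'a::complex_hilbert set \<Rightarrow> ('a \<Rightarrow> 'a) \<Rightarrow> real \<Rightarrow> 'a set" where
  "scale_space D A r = spectral_dom D A (\<lambda>x. (1 + x) powr r)"

definition scale_norm :: "'a::complex_hilbert set \<Rightarrow> ('a \<Rightarrow> 'a) \<Rightarrow> real \<Rightarrow> 'a \<Rightarrow> real" where
  "scale_norm D A r u = norm (spectral_fun D A (\<lambda>x. (1 + x) powr r) u)"

definition bounded_from_scale ::
    "'a::complex_hilbert set \<Rightarrow> ('a \<Rightarrow> 'a) \<Rightarrow> real \<Rightarrow> ('a \<Rightarrow> 'a) \<Rightarrow> bool" where
  "bounded_from_scale D A r B \<longleftrightarrow> clinear_on (scale_space D A r) B \<and>
     (\<exists>C. \<forall>u\<in>scale_space D A r. norm (B u) \<le> C * scale_norm D A r u)"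

definition scale_opnorm ::
    "'a::complex_hilbert set \<Rightarrow> ('a \<Rightarrow> 'a) \<Rightarrow> real \<Rightarrow> ('a \<Rightarrow> 'a) \<Rightarrow> real" where
  "scale_opnorm D A r B =
     (SUP u\<in>{u \<in> scale_space D A r. scale_norm D A r u \<le> 1}. norm (B u))"

section \<open>Propagators\<close>

text \<open>\<open>\<i> \<partial>\<^sub>t \<psi>(t) = H(t) \<psi>(t)\<close> for all \<open>t\<close> in \<open>I\<close>, with one-sided derivatives at the end points.\<close>

definition schroedinger_solution ::
    "real set \<Rightarrow> (real \<Rightarrow> 'a::complex_hilbert \<Rightarrow> 'a) \<Rightarrow> (real \<Rightarrow> 'a) \<Rightarrow> bool" where
  "schroedinger_solution I H \<psi> \<longleftrightarrow>
     (\<forall>t\<in>I. \<exists>d. (\<psi> has_vector_derivative d) (at t within I) \<and> \<i> *\<^sub>C d = H t (\<psi> t))"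

definition unitary_propagator ::
    "real set \<Rightarrow> (real \<Rightarrow> real \<Rightarrow> 'a::complex_hilbert \<Rightarrow> 'a) \<Rightarrow> bool" where
  "unitary_propagator I U \<longleftrightarrow>
     (\<forall>t\<in>I. \<forall>s\<in>I. unitary_op (U t s)) \<and>
     (\<forall>u. continuous_on (I \<times> I) (\<lambda>(t, s). U t s u)) \<and>
     (\<forall>t\<in>I. \<forall>r\<in>I. \<forall>s\<in>I. \<forall>u. U t r (U r s u) = U t s u) \<and>
     (\<forall>s\<in>I. \<forall>u. U s s u = u)"

definition galerkin_hamiltonian :: "'a::complex_hilbert set \<Rightarrow> ('a \<Rightarrow> 'a) \<Rightarrow>
    (real \<Rightarrow> 'a \<Rightarrow> 'a) \<Rightarrow> real \<Rightarrow> real \<Rightarrow> 'a \<Rightarrow> 'a" where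
  "galerkin_hamiltonian D A H N t v = spectral_proj D A N (H t (spectral_proj D A N v))"

text \<open>\<open>V\<close> solves the Cauchy problem for \<open>P\<^sub>N H(t) P\<^sub>N\<close> on the range of \<open>P\<^sub>N\<close>. For symmetric,
  continuous \<open>P\<^sub>N H(t) P\<^sub>N\<close> this determines \<open>V\<close> on that range, and unitarity and the composition
  law follow.\<close>

definition galerkin_propagator :: "'a::complex_hilbert set \<Rightarrow> ('a \<Rightarrow> 'a) \<Rightarrow> real set \<Rightarrow>
    (real \<Rightarrow> 'a \<Rightarrow> 'a) \<Rightarrow> real \<Rightarrow> (real \<Rightarrow> real \<Rightarrow> 'a \<Rightarrow> 'a) \<Rightarrow> bool" where
  "galerkin_propagator D A I H N V \<longleftrightarrow>
     (\<forall>s\<in>I. \<forall>v\<in>range (spectral_proj D A N).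
        (\<forall>t\<in>I. V t s v \<in> range (spectral_proj D A N)) \<and>
        schroedinger_solution I (galerkin_hamiltonian D A H N) (\<lambda>t. V t s v) \<and>
        V s s v = v)"

end

theory Submission
  imports Defs
begin

text \<open>The eigenprojections of the operator with compact resolvent resolve the identity, so the
  spectral projections converge to the identity in every norm of the scale, and do so uniformly on
  the compact orbit of \<open>u\<close> under the propagator. The difference of the Galerkin solution and the
  projection of the exact one grows in norm at a rate bounded, up to a constant uniform in time, by
  the scale norm of the discarded part of the exact solution, because the generator has a real
  quadratic form on the scale. That form is real since the propagator preserves the norm.\<close>

section \<open>Inner product and norm\<close>

text \<open>The obstacle is that \<open>P_N H(t) P_N\<close> need not be bounded uniformly in
  \<open>N\<close>: a Gronwall argument with its operator norm, or an error measured in the scale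
  norm, would bring in constants that grow with \<open>N\<close>. The estimate is therefore arranged
  so that the error \<open>w\<close> is only ever measured in the plain norm, while the bound on
  \<open>H(t)\<close> is spent solely on the discarded part of the exact solution. If that part has
  scale norm at most \<delta>, the source term has size \<open>C * \<delta>\<close> and acts during
  a time at most \<open>b - a\<close>; this is the origin of the constant
  \<open>2 * C * (b - a) + 1\<close>, whose last summand pays for the discarded part itself. One
  \<delta> serves all pairs \<open>(t, s)\<close> because \<open>1 - P_N\<close> is a contraction
  for the scale norm, which carries smallness at one point over to its neighbours with the same
  cutoff. Functions of the operator are defined as sums over eigenspaces, so the totality of the
  eigenvectors has to be established before they can be used; it comes from the compact symmetric
  operator \<open>(1 + A)^{-1}\<close>.\<close>

instance complex_hilbert \<subseteq> banach ..

lemma cinner_add_left: "cinner (x + y) z = cinner x z + cinner y (z :: 'a::complex_hilbert)"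
  by (metis cinner_add_right cinner_commute complex_cnj_add)

lemma cinner_scaleC_left: "cinner (c *\<^sub>C x) y = cnj c * cinner x (y :: 'a::complex_hilbert)"
  by (metis cinner_commute cinner_scaleC_right complex_cnj_mult)

lemma cinner_scaleR_right: "cinner x (r *\<^sub>R y) = of_real r * cinner x (y :: 'a::complex_hilbert)"
  by (metis cinner_scaleC_right scaleC_of_real)

lemma cinner_scaleR_left: "cinner (r *\<^sub>R x) y = of_real r * cinner x (y :: 'a::complex_hilbert)"
  by (metis cinner_scaleC_left complex_cnj_complex_of_real scaleC_of_real)

lemma cinner_zero_right [simp]: "cinner x (0 :: 'a::complex_hilbert) = 0"
  by (metis add_0 add_cancel_right_left cinner_add_right)

lemma cinner_minus_right: "cinner x (- y) = - cinner x (y :: 'a::complex_hilbert)"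
  using cinner_scaleR_right[of x "-1" y] by simp

lemma cinner_diff_right: "cinner x (y - z) = cinner x y - cinner x (z :: 'a::complex_hilbert)"
  by (simp add: cinner_add_right cinner_minus_right diff_conv_add_uminus del: add_uminus_conv_diff)

lemma cinner_eq_zero_commute: "cinner x y = 0 \<longleftrightarrow> cinner y (x :: 'a::complex_hilbert) = 0"
  by (metis cinner_commute complex_cnj_zero)

lemma scaleC_zero_right [simp]: "c *\<^sub>C (0 :: 'a::complex_hilbert) = 0"
  by (metis add_cancel_right_right scaleC_add_right)

lemma scaleC_minus_right: "c *\<^sub>C (- x) = - (c *\<^sub>C (x :: 'a::complex_hilbert))"
  by (metis add.right_inverse add_eq_0_iff scaleC_add_right scaleC_zero_right)

lemma scaleC_diff_right: "c *\<^sub>C (x - y) = c *\<^sub>C x - c *\<^sub>C (y :: 'a::complex_hilbert)"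
  by (simp add: scaleC_add_right scaleC_minus_right diff_conv_add_uminus del: add_uminus_conv_diff)

lemma scaleC_minus_left: "(- c) *\<^sub>C x = - (c *\<^sub>C (x :: 'a::complex_hilbert))"
  by (metis add.right_inverse add_eq_0_iff of_real_0 scaleC_add_left scaleC_of_real scaleR_zero_left)

lemma scaleC_scaleR_commute: "c *\<^sub>C (r *\<^sub>R x) = r *\<^sub>R (c *\<^sub>C (x :: 'a::complex_hilbert))"
  by (metis mult.commute scaleC_of_real scaleC_scaleC)

lemma scaleC_one [simp]: "1 *\<^sub>C x = (x :: 'a::complex_hilbert)"
  by (metis of_real_1 scaleC_of_real scaleR_one)

lemma Re_cinner_self: "Re (cinner x x) = (norm (x :: 'a::complex_hilbert))\<^sup>2"
  by (simp add: cinner_self)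

lemma Re_cinner_commute: "Re (cinner x y) = Re (cinner y (x :: 'a::complex_hilbert))"
  unfolding cinner_commute[of x y] by simp

lemma norm_add_square:
  "(norm (x + y))\<^sup>2 = (norm x)\<^sup>2 + 2 * Re (cinner x y) + (norm (y :: 'a::complex_hilbert))\<^sup>2"
  using Re_cinner_commute[of x y]
  by (simp add: Re_cinner_self[symmetric] cinner_add_left cinner_add_right)

lemma norm_diff_square:
  "(norm (x - y))\<^sup>2 = (norm x)\<^sup>2 - 2 * Re (cinner x y) + (norm (y :: 'a::complex_hilbert))\<^sup>2"
  using norm_add_square[of x "- y"] by (simp add: cinner_minus_right)

lemma norm_add_square_orthogonal:
  "cinner x (y :: 'a::complex_hilbert) = 0 \<Longrightarrow> (norm (x + y))\<^sup>2 = (norm x)\<^sup>2 + (norm y)\<^sup>2"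
  by (simp add: norm_add_square)

lemma norm_scaleC: "norm (c *\<^sub>C x) = cmod c * norm (x :: 'a::complex_hilbert)"
proof -
  have "(norm (c *\<^sub>C x))\<^sup>2 = (cmod c * norm x)\<^sup>2"
  proof -
    have "cinner (c *\<^sub>C x) (c *\<^sub>C x) = (c * cnj c) * cinner x x"
      by (simp add: cinner_scaleC_left cinner_scaleC_right)
    also have "\<dots> = of_real ((cmod c * norm x)\<^sup>2)"
      by (simp add: cinner_self complex_norm_square[symmetric] power_mult_distrib)
    finally have "Re (cinner (c *\<^sub>C x) (c *\<^sub>C x)) = (cmod c * norm x)\<^sup>2" by simp
    then show ?thesis by (simp only: Re_cinner_self)
  qed
  then show ?thesis by (simp add: power2_eq_iff_nonneg)
qed

text \<open>The usual order is reversed: the class already supplies the triangle inequality, and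
  squaring it yields Cauchy-Schwarz for the real part.\<close>

lemma Re_cinner_le: "Re (cinner x y) \<le> norm x * norm (y :: 'a::complex_hilbert)"
proof -
  have "(norm (x + y))\<^sup>2 \<le> (norm x + norm y)\<^sup>2"
    by (simp add: norm_triangle_ineq power_mono)
  then show ?thesis by (simp add: norm_add_square power2_sum)
qed

lemma cinner_Cauchy_Schwarz: "cmod (cinner x y) \<le> norm x * norm (y :: 'a::complex_hilbert)"
proof (cases "cinner x y = 0")
  case False
  \<comment> \<open>A phase that turns the inner product into its modulus, so that the bound on real
    parts applies.\<close>
  define c where "c = cnj (cinner x y) / of_real (cmod (cinner x y))"
  have c: "cmod c = 1" using False by (simp add: c_def norm_divide)
  have "c * cinner x y = of_real (cmod (cinner x y))"
    using False by (simp add: c_def mult.commute[of "cnj _"] complex_norm_square[symmetric] power2_eq_square)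
  then have "cmod (cinner x y) = Re (cinner x (c *\<^sub>C y))" by (simp add: cinner_scaleC_right)
  also have "\<dots> \<le> norm x * norm y" using Re_cinner_le[of x "c *\<^sub>C y"] c by (simp add: norm_scaleC)
  finally show ?thesis .
qed simp

lemma bounded_bilinear_cinner:
  "bounded_bilinear (cinner :: 'a::complex_hilbert \<Rightarrow> 'a \<Rightarrow> complex)"
  by (rule bounded_bilinear.intro)
     (auto simp: cinner_add_left cinner_add_right cinner_scaleR_left cinner_scaleR_right
        scaleR_conv_of_real intro!: exI[of _ 1] cinner_Cauchy_Schwarz)

lemmas bounded_linear_cinner_right = bounded_bilinear.bounded_linear_right[OF bounded_bilinear_cinner]

lemma bounded_linear_scaleC: "bounded_linear (\<lambda>x :: 'a::complex_hilbert. c *\<^sub>C x)"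
  by (rule bounded_linear_intro[where K = "cmod c"])
     (auto simp: scaleC_add_right scaleC_scaleR_commute norm_scaleC mult.commute)

lemma csubspace_scaleR: "csubspace S \<Longrightarrow> x \<in> S \<Longrightarrow> r *\<^sub>R x \<in> S"
  by (metis csubspace_def scaleC_of_real)

lemma csubspace_diff: "csubspace S \<Longrightarrow> x \<in> S \<Longrightarrow> y \<in> S \<Longrightarrow> x - y \<in> S"
  using csubspace_scaleR[of S y "-1"] unfolding csubspace_def
  by (metis diff_conv_add_uminus scaleR_minus1_left)

section \<open>Orthogonal projections\<close>

lemma parallelogram_law:
  fixes x y :: "'a::complex_hilbert"
  shows "(norm (x + y))\<^sup>2 + (norm (x - y))\<^sup>2 = 2 * (norm x)\<^sup>2 + 2 * (norm y)\<^sup>2"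
  by (simp add: norm_add_square norm_diff_square)

text \<open>Moving \<open>p\<close> along \<open>m\<close> inside \<open>M\<close> cannot bring it
  closer to \<open>u\<close>, so the first-order change of the distance vanishes. The direction
  \<open>m\<close> yields the real part, \<open>\<i> *\<^sub>C m\<close> the imaginary part.\<close>

lemma closest_point_orthogonal:
  fixes M :: "'a::complex_hilbert set"
  assumes M: "csubspace M" and p: "p \<in> M" and min: "\<And>m. m \<in> M \<Longrightarrow> norm (u - p) \<le> norm (u - m)"
    and m: "m \<in> M"
  shows "cinner m (u - p) = 0"
proof -
  have Re0: "Re (cinner (u - p) m) = 0" if m: "m \<in> M" for m
  proof -
    define r where "r = Re (cinner (u - p) m)"
    define q where "q = (norm m)\<^sup>2"
    \<comment> \<open>The minimising step would be \<open>r / q\<close>; the \<open>+ 1\<close>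
      keeps the denominator positive when \<open>m = 0\<close> and still contradicts minimality
      unless \<open>r = 0\<close>.\<close>
    define t where "t = r / (q + 1)"
    have q: "q \<ge> 0" by (simp add: q_def)
    have "p + t *\<^sub>R m \<in> M" using M p csubspace_scaleR[OF M m] by (auto simp: csubspace_def)
    from min[OF this] have "(norm (u - p))\<^sup>2 \<le> (norm ((u - p) - t *\<^sub>R m))\<^sup>2"
      by (simp add: power_mono algebra_simps)
    then have "2 * (t * r) \<le> t\<^sup>2 * q"
      by (simp add: norm_diff_square cinner_scaleR_right r_def q_def power_mult_distrib)
    moreover have "t * r = t\<^sup>2 * (q + 1)" using q by (simp add: t_def power2_eq_square)
    ultimately have "t\<^sup>2 * (q + 2) \<le> 0" by (simp add: algebra_simps)
    then have "t\<^sup>2 = 0" using q by (metis add_nonneg_pos mult_le_0_iff not_less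
        zero_le_power2 zero_less_numeral order_antisym)
    then show ?thesis using q by (simp add: t_def r_def)
  qed
  have "\<i> *\<^sub>C m \<in> M" using M m by (auto simp: csubspace_def)
  from Re0[OF this] have "Im (cinner (u - p) m) = 0" by (simp add: cinner_scaleC_right)
  with Re0[OF m] have "cinner (u - p) m = 0" by (simp add: complex_eq_iff)
  then show ?thesis by (simp add: cinner_eq_zero_commute)
qed

text \<open>A minimising sequence for the distance to \<open>u\<close> is Cauchy: the midpoint of
  two of its terms lies in \<open>M\<close>, so the parallelogram law bounds their difference by
  their excess over the infimum \<open>d\<close>.\<close>

lemma orth_proj_exists:
  fixes M :: "'a::complex_hilbert set"
  assumes M: "csubspace M" and "closed M"
  shows "\<exists>p\<in>M. \<forall>m\<in>M. cinner m (u - p) = 0"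
proof -
  define d where "d = (INF m\<in>M. (norm (u - m))\<^sup>2)"
  have ne: "M \<noteq> {}" using M by (auto simp: csubspace_def)
  have bdd: "bdd_below ((\<lambda>m. (norm (u - m))\<^sup>2) ` M)" by (rule bdd_belowI[of _ 0]) auto
  have dle: "d \<le> (norm (u - m))\<^sup>2" if "m \<in> M" for m
    unfolding d_def using bdd that by (rule cINF_lower)
  have "\<exists>m\<in>M. (norm (u - m))\<^sup>2 < d + e" if "e > 0" for e
  proof -
    have "(INF m\<in>M. (norm (u - m))\<^sup>2) < d + e" using that by (simp add: d_def)
    then show ?thesis using bdd ne by (simp add: cINF_less_iff)
  qed
  then have "\<forall>n. \<exists>m\<in>M. (norm (u - m))\<^sup>2 < d + inverse (real (Suc n))" by simp
  then obtain X where X: "\<And>n. X n \<in> M" "\<And>n. (norm (u - X n))\<^sup>2 < d + inverse (real (Suc n))"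
    by metis
  have dist: "(norm (X i - X j))\<^sup>2 \<le> 2 * inverse (real (Suc i)) + 2 * inverse (real (Suc j))" for i j
  proof -
    have "(1/2) *\<^sub>R (X i + X j) \<in> M"
      using X(1) M by (intro csubspace_scaleR) (auto simp: csubspace_def)
    from dle[OF this] have "4 * d \<le> (2 * norm (u - (1/2) *\<^sub>R (X i + X j)))\<^sup>2"
      by (simp add: power_mult_distrib)
    also have "2 * norm (u - (1/2) *\<^sub>R (X i + X j)) = norm ((u - X i) + (u - X j))"
    proof -
      have "(u - X i) + (u - X j) = 2 *\<^sub>R (u - (1/2) *\<^sub>R (X i + X j))"
        by (simp add: scaleR_2 algebra_simps)
      then show ?thesis by simp
    qed
    finally have "4 * d \<le> (norm ((u - X i) + (u - X j)))\<^sup>2" .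
    moreover have "norm ((u - X i) - (u - X j)) = norm (X i - X j)"
      by (simp add: norm_minus_commute)
    ultimately show ?thesis
      using parallelogram_law[of "u - X i" "u - X j"] X(2)[of i] X(2)[of j] by auto
  qed
  have "Cauchy X"
  proof (rule metric_CauchyI)
    fix e :: real assume e: "e > 0"
    then obtain N where N: "inverse (real (Suc N)) < e\<^sup>2 / 4"
      using reals_Archimedean[of "e\<^sup>2 / 4"] by auto
    have "dist (X i) (X j) < e" if "i \<ge> N" "j \<ge> N" for i j
    proof -
      have "inverse (real (Suc i)) \<le> inverse (real (Suc N))"
        "inverse (real (Suc j)) \<le> inverse (real (Suc N))" using that by (auto simp: field_simps)
      then have "(norm (X i - X j))\<^sup>2 < e\<^sup>2" using dist[of i j] N by linarith
      then show ?thesis using e by (simp add: dist_norm power2_less_imp_less)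
    qed
    then show "\<exists>N. \<forall>i\<ge>N. \<forall>j\<ge>N. dist (X i) (X j) < e" by blast
  qed
  then obtain p where p: "X \<longlonglongrightarrow> p" using Cauchy_convergent convergent_def by blast
  have pM: "p \<in> M" using \<open>closed M\<close> X(1) p by (metis closed_sequentially)
  have "(\<lambda>n. (norm (u - X n))\<^sup>2) \<longlonglongrightarrow> (norm (u - p))\<^sup>2" by (intro tendsto_intros p)
  moreover have "(\<lambda>n. d + inverse (real (Suc n))) \<longlonglongrightarrow> d + 0"
    by (intro tendsto_intros LIMSEQ_inverse_real_of_nat)
  ultimately have "(norm (u - p))\<^sup>2 \<le> d + 0"
    by (rule LIMSEQ_le) (use X(2) less_imp_le in blast)
  then have "(norm (u - p))\<^sup>2 \<le> (norm (u - m))\<^sup>2" if "m \<in> M" for m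
    using dle[OF that] by (metis add.right_neutral order_trans)
  then have "norm (u - p) \<le> norm (u - m)" if "m \<in> M" for m
    using that by (meson norm_ge_zero power2_le_imp_le)
  then show ?thesis using closest_point_orthogonal[OF M pM] pM by blast
qed

context
  fixes M :: "'a::complex_hilbert set"
  assumes M: "csubspace M" "closed M"
begin

text \<open>Two candidates differ by an element of \<open>M\<close> that is orthogonal to itself.
  This gives the \<open>THE\<close> in \<open>orth_proj\<close> its value and is how the algebraic
  laws below are checked.\<close>

lemma orth_proj_unique:
  assumes "p \<in> M" "\<And>m. m \<in> M \<Longrightarrow> cinner m (u - p) = 0"
  shows "orth_proj M u = p"
  unfolding orth_proj_def
proof (rule the_equality)
  fix q assume q: "q \<in> M \<and> (\<forall>m\<in>M. cinner m (u - q) = 0)"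
  have "q - p \<in> M" using q assms(1) M csubspace_diff by blast
  then have "cinner (q - p) (u - p) = 0" "cinner (q - p) (u - q) = 0"
    using q assms(2) by blast+
  then have "cinner (q - p) ((u - p) - (u - q)) = 0"
    by (simp only: cinner_diff_right diff_zero)
  then have "cinner (q - p) (q - p) = 0" by simp
  then show "q = p" by (simp add: cinner_self)
qed (use assms in auto)

lemma orth_proj_in: "orth_proj M u \<in> M"
  and orth_proj_orthogonal: "m \<in> M \<Longrightarrow> cinner m (u - orth_proj M u) = 0"
proof -
  obtain p where "p \<in> M" "\<forall>m\<in>M. cinner m (u - p) = 0" using orth_proj_exists[OF M] by blast
  moreover from this have "orth_proj M u = p" by (intro orth_proj_unique) auto
  ultimately show "orth_proj M u \<in> M" "m \<in> M \<Longrightarrow> cinner m (u - orth_proj M u) = 0" by auto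
qed

lemma orth_proj_add: "orth_proj M (u + v) = orth_proj M u + orth_proj M v"
proof (rule orth_proj_unique)
  show "orth_proj M u + orth_proj M v \<in> M"
    using M orth_proj_in by (auto simp: csubspace_def)
  show "cinner m (u + v - (orth_proj M u + orth_proj M v)) = 0" if "m \<in> M" for m
    using orth_proj_orthogonal[OF that, of u] orth_proj_orthogonal[OF that, of v]
    by (simp add: cinner_diff_right cinner_add_right)
qed

lemma orth_proj_scaleC: "orth_proj M (c *\<^sub>C u) = c *\<^sub>C orth_proj M u"
proof (rule orth_proj_unique)
  show "c *\<^sub>C orth_proj M u \<in> M"
    using M orth_proj_in by (auto simp: csubspace_def)
  show "cinner m (c *\<^sub>C u - c *\<^sub>C orth_proj M u) = 0" if "m \<in> M" for m
    using orth_proj_orthogonal[OF that, of u]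
    by (simp add: scaleC_diff_right[symmetric] cinner_scaleC_right)
qed

lemma orth_proj_id: "u \<in> M \<Longrightarrow> orth_proj M u = u"
  by (rule orth_proj_unique) auto

lemma orth_proj_zero: "(\<And>m. m \<in> M \<Longrightarrow> cinner m u = 0) \<Longrightarrow> orth_proj M u = 0"
  by (rule orth_proj_unique) (use M in \<open>auto simp: csubspace_def\<close>)

lemma cinner_orth_proj_left: "cinner (orth_proj M u) v = cinner (orth_proj M u) (orth_proj M v)"
  using orth_proj_orthogonal[OF orth_proj_in[of u], of v] by (simp add: cinner_diff_right)

lemma norm_orth_proj_le: "norm (orth_proj M u) \<le> norm u"
proof -
  have "(norm (orth_proj M u + (u - orth_proj M u)))\<^sup>2
      = (norm (orth_proj M u))\<^sup>2 + (norm (u - orth_proj M u))\<^sup>2"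
    by (rule norm_add_square_orthogonal) (simp add: orth_proj_orthogonal orth_proj_in)
  then show ?thesis by (simp add: power2_le_imp_le)
qed

lemma bounded_linear_orth_proj: "bounded_linear (orth_proj M)"
proof (rule bounded_linear_intro[where K = 1])
  show "orth_proj M (r *\<^sub>R x) = r *\<^sub>R orth_proj M x" for r x
    using orth_proj_scaleC[of "of_real r" x] by (simp add: scaleC_of_real)
qed (simp_all add: orth_proj_add norm_orth_proj_le)

end

section \<open>Sums of orthogonal families\<close>

lemma cinner_sum_right: "cinner x (\<Sum>i\<in>F. y i) = (\<Sum>i\<in>F. cinner x (y i :: 'a::complex_hilbert))"
  by (induction F rule: infinite_finite_induct) (simp_all add: cinner_add_right)

lemma norm_sum_orthogonal:
  fixes x :: "'i \<Rightarrow> 'a::complex_hilbert"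
  assumes "finite F" "\<And>i j. i \<in> F \<Longrightarrow> j \<in> F \<Longrightarrow> i \<noteq> j \<Longrightarrow> cinner (x i) (x j) = 0"
  shows "(norm (\<Sum>i\<in>F. x i))\<^sup>2 = (\<Sum>i\<in>F. (norm (x i))\<^sup>2)"
  using assms
proof (induction F rule: finite_induct)
  case (insert i F)
  have "cinner (x i) (\<Sum>i\<in>F. x i) = 0"
    unfolding cinner_sum_right using insert.prems insert.hyps(2) by (intro sum.neutral) auto
  then show ?case using insert by (simp add: norm_add_square_orthogonal)
qed simp

text \<open>By Pythagoras, the sums of \<open>x\<close> over far-out finite sets are as small as
  those of the squared norms. Since the norms themselves need not be summable, comparison fails and
  the net of partial sums is shown to be Cauchy.\<close>

lemma summable_on_orthogonal:
  fixes x :: "'i \<Rightarrow> 'a::complex_hilbert"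
  assumes orth: "\<And>i j. i \<in> A \<Longrightarrow> j \<in> A \<Longrightarrow> i \<noteq> j \<Longrightarrow> cinner (x i) (x j) = 0"
    and sq: "(\<lambda>i. (norm (x i))\<^sup>2) summable_on A"
  shows "x summable_on A"
proof -
  define n where "n = (\<lambda>i. (norm (x i))\<^sup>2)"
  obtain L where L: "(sum n \<longlongrightarrow> L) (finite_subsets_at_top A)"
    using sq by (auto simp: n_def summable_on_def has_sum_def)
  have "\<exists>P. eventually P (finite_subsets_at_top A)
      \<and> (\<forall>F G. P F \<and> P G \<longrightarrow> dist (sum x F) (sum x G) < e)" if e: "e > 0" for e
  proof -
    \<comment> \<open>Two sums within \<open>d\<close> of \<open>L\<close> differ by less than
      \<open>2 * d = (e / 2)\<^sup>2\<close>; the half of \<open>e\<close> is for the triangle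
      inequality through \<open>F0\<close>.\<close>
    define d where "d = (e / 2)\<^sup>2 / 2"
    have "d > 0" using e by (simp add: d_def)
    then have "\<forall>\<^sub>F F in finite_subsets_at_top A. dist (sum n F) L < d"
      using L by (rule tendstoD[rotated])
    then obtain F0 where F0: "finite F0" "F0 \<subseteq> A"
      and d: "\<And>F. finite F \<Longrightarrow> F0 \<subseteq> F \<Longrightarrow> F \<subseteq> A \<Longrightarrow> dist (sum n F) L < d"
      unfolding eventually_finite_subsets_at_top by metis
    define P where "P F \<longleftrightarrow> finite F \<and> F0 \<subseteq> F \<and> F \<subseteq> A" for F
    have evP: "eventually P (finite_subsets_at_top A)"
      unfolding eventually_finite_subsets_at_top using F0 by (intro exI[of _ F0]) (simp add: P_def)
    have near: "dist (sum x F) (sum x F0) < e / 2" if "P F" for F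
    proof -
      have F: "finite F" "F0 \<subseteq> F" "F \<subseteq> A" using that by (auto simp: P_def)
      have "(norm (sum x (F - F0)))\<^sup>2 = sum n (F - F0)"
        unfolding n_def using F by (intro norm_sum_orthogonal orth) auto
      also have "\<dots> = sum n F - sum n F0" using F by (simp add: sum_diff)
      also have "\<dots> < 2 * d"
        using d[OF F] d[OF F0(1) order_refl F0(2)] unfolding dist_real_def by linarith
      also have "2 * d = (e / 2)\<^sup>2" by (simp add: d_def)
      finally have "norm (sum x (F - F0)) < e / 2"
        by (rule power2_less_imp_less) (use e in simp)
      then show ?thesis using F by (simp add: dist_norm sum_diff)
    qed
    have "dist (sum x F) (sum x G) < e" if "P F" "P G" for F G
      using near[OF that(1)] near[OF that(2)] by (rule dist_triangle_half_l)
    then show ?thesis using evP by (intro exI[of _ P] conjI allI impI) auto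
  qed
  then have "cauchy_filter (filtermap (sum x) (finite_subsets_at_top A))"
    unfolding cauchy_filter_metric_filtermap by (intro allI impI)
  moreover have "complete (UNIV :: 'a set)"
    by (meson Cauchy_convergent UNIV_I complete_def convergent_def)
  ultimately obtain S where "(sum x \<longlongrightarrow> S) (finite_subsets_at_top A)"
    using complete_uniform[where S = UNIV] by (force simp: filterlim_def)
  then show ?thesis by (auto simp: summable_on_def has_sum_def)
qed

lemma has_sum_orthogonal_norm:
  fixes x :: "'i \<Rightarrow> 'a::complex_hilbert"
  assumes orth: "\<And>i j. i \<in> A \<Longrightarrow> j \<in> A \<Longrightarrow> i \<noteq> j \<Longrightarrow> cinner (x i) (x j) = 0"
    and S: "(x has_sum S) A"
  shows "((\<lambda>i. (norm (x i))\<^sup>2) has_sum (norm S)\<^sup>2) A"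
proof -
  have "((\<lambda>F. (norm (sum x F))\<^sup>2) \<longlongrightarrow> (norm S)\<^sup>2) (finite_subsets_at_top A)"
    using S unfolding has_sum_def by (intro tendsto_intros)
  moreover have "\<forall>\<^sub>F F in finite_subsets_at_top A. (norm (sum x F))\<^sup>2 = (\<Sum>i\<in>F. (norm (x i))\<^sup>2)"
    unfolding eventually_finite_subsets_at_top
    by (intro exI[of _ "{}"]) (auto intro!: norm_sum_orthogonal orth)
  ultimately show ?thesis unfolding has_sum_def by (rule Lim_transform_eventually)
qed

section \<open>Eigenvector expansion\<close>

context
  fixes D :: "'a::complex_hilbert set" and A :: "'a \<Rightarrow> 'a"
  assumes pos: "positive_op_compact_resolvent D A"
begin

lemma op_domain: "csubspace D"
  and op_linear: "clinear_on D A"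
  using pos
  unfolding positive_op_compact_resolvent_def selfadjoint_op_def densely_defined_op_def by blast+

text \<open>The pair \<open>(v, A v)\<close> lies in the graph of the adjoint: the direction from
  right to left in \<open>selfadjoint_op\<close>.\<close>

lemma op_symmetric: "u \<in> D \<Longrightarrow> v \<in> D \<Longrightarrow> cinner (A v) u = cinner v (A u)"
  using pos unfolding positive_op_compact_resolvent_def selfadjoint_op_def by metis

lemma op_add: "u \<in> D \<Longrightarrow> v \<in> D \<Longrightarrow> A (u + v) = A u + A v"
  using op_linear by (simp add: clinear_on_def)

lemma op_scaleC: "u \<in> D \<Longrightarrow> A (c *\<^sub>C u) = c *\<^sub>C A u"
  using op_linear by (simp add: clinear_on_def)

lemma op_scaleR: "u \<in> D \<Longrightarrow> A (r *\<^sub>R u) = r *\<^sub>R A u"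
  using op_scaleC[of u "of_real r"] by (simp add: scaleC_of_real)

lemma op_zero: "A 0 = 0" "0 \<in> D"
  using op_scaleR[of 0 0] op_domain by (auto simp: csubspace_def)

text \<open>An eigenvector destroys injectivity of \<open>A - l\<close>, which puts \<open>l\<close>
  into the spectrum. The weights \<open>(1 + l) powr r\<close> depend on this sign.\<close>

lemma eigenvalues_nonneg:
  assumes "l \<in> eigenvalues D A"
  shows "0 \<le> l"
proof -
  obtain u where u: "u \<in> D" "A u = l *\<^sub>R u" "u \<noteq> 0"
    using assms by (auto simp: eigenvalues_def eigenspace_def)
  have "A u - of_real l *\<^sub>C u = A 0 - of_real l *\<^sub>C 0"
    using u op_zero by (simp add: scaleC_of_real)
  then have "\<not> inj_on (\<lambda>u. A u - of_real l *\<^sub>C u) D"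
    using u(1,3) op_zero(2) unfolding inj_on_def by blast
  then have "of_real l \<in> spectrum D A"
    by (auto simp: spectrum_def resolvent_set_def bij_betw_def)
  then show ?thesis using pos by (auto simp: positive_op_compact_resolvent_def)
qed

text \<open>This is \<open>(1 + A)^{-1}\<close>, the point -1 lying off the spectrum. It is bounded,
  symmetric and compact, and the spectral theory of the unbounded \<open>A\<close> is read off from
  it.\<close>

definition inv_op where "inv_op = resolvent D A (- 1)"

lemma minus_one_resolvent: "- 1 \<in> resolvent_set D A"
proof (rule ccontr)
  assume "\<not> ?thesis"
  then have "- 1 \<in> complex_of_real ` {0..}"
    using pos by (auto simp: spectrum_def positive_op_compact_resolvent_def)
  then obtain r :: real where "r \<ge> 0" "- 1 = complex_of_real r" by auto
  then show False by (auto simp: complex_eq_iff)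
qed

lemma resolvent_in: "z \<in> resolvent_set D A \<Longrightarrow> resolvent D A z x \<in> D"
  unfolding resolvent_set_def resolvent_def bij_betw_def
  by (rule the_inv_into_into) auto

lemma resolvent_right:
  "z \<in> resolvent_set D A \<Longrightarrow> A (resolvent D A z x) - z *\<^sub>C resolvent D A z x = x"
  unfolding resolvent_set_def resolvent_def bij_betw_def
  by (rule f_the_inv_into_f[of "\<lambda>u. A u - z *\<^sub>C u"]) auto

lemma resolvent_left:
  "z \<in> resolvent_set D A \<Longrightarrow> u \<in> D \<Longrightarrow> resolvent D A z (A u - z *\<^sub>C u) = u"
  unfolding resolvent_set_def resolvent_def bij_betw_def
  by (rule the_inv_into_f_f[of "\<lambda>u. A u - z *\<^sub>C u"]) auto

lemma inv_op_in: "inv_op x \<in> D"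
  using resolvent_in[OF minus_one_resolvent] by (simp add: inv_op_def)

lemma op_inv_op: "A (inv_op x) = x - inv_op x"
  using resolvent_right[OF minus_one_resolvent, of x]
  by (simp add: inv_op_def scaleC_minus_left algebra_simps)

lemma inv_op_op: "u \<in> D \<Longrightarrow> inv_op (A u + u) = u"
  using resolvent_left[OF minus_one_resolvent, of u]
  by (simp add: inv_op_def scaleC_minus_left)

lemma inv_op_eqI: "u \<in> D \<Longrightarrow> A u + u = x \<Longrightarrow> inv_op x = u"
  using inv_op_op by blast

lemma inv_op_add: "inv_op (x + y) = inv_op x + inv_op y"
  using inv_op_in[of x] inv_op_in[of y] op_domain
  by (intro inv_op_eqI) (auto simp: op_add op_inv_op csubspace_def)

lemma inv_op_scaleR: "inv_op (r *\<^sub>R x) = r *\<^sub>R inv_op x"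
  using inv_op_in[of x] op_domain
  by (intro inv_op_eqI) (auto simp: op_scaleR op_inv_op csubspace_scaleR algebra_simps)

lemma bounded_linear_inv_op: "bounded_linear inv_op"
proof -
  obtain C where C: "\<And>u. u \<in> D \<Longrightarrow> norm u \<le> C * norm (A u - (- 1) *\<^sub>C u)"
    using minus_one_resolvent by (auto simp: resolvent_set_def)
  show ?thesis
  proof (rule bounded_linear_intro[where K = C])
    show "norm (inv_op x) \<le> norm x * C" for x
      using C[OF inv_op_in[of x]] by (simp add: op_inv_op scaleC_minus_left mult.commute)
  qed (simp_all add: inv_op_add inv_op_scaleR)
qed

lemma inv_op_symmetric: "cinner (inv_op x) y = cinner x (inv_op y)"
proof -
  have "cinner (inv_op x) y = cinner (inv_op x) (A (inv_op y) + inv_op y)" by (simp add: op_inv_op)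
  also have "\<dots> = cinner (A (inv_op x) + inv_op x) (inv_op y)"
    using op_symmetric[OF inv_op_in[of y] inv_op_in[of x]]
    by (simp add: cinner_add_left cinner_add_right)
  finally show ?thesis by (simp add: op_inv_op)
qed

text \<open>Compactness is given at some unknown \<open>z\<close> only. The resolvent identity
  transfers it: \<open>g x\<close> is \<open>A - z\<close> applied to \<open>inv_op x\<close>, so
  \<open>inv_op\<close> is the resolvent at \<open>z\<close> after the bounded map
  \<open>g\<close>.\<close>

lemma compact_inv_op:
  assumes "bounded S"
  shows "compact (closure (inv_op ` S))"
proof -
  obtain z where z: "z \<in> resolvent_set D A"
    and cpt: "\<And>S. bounded S \<Longrightarrow> compact (closure (resolvent D A z ` S))"
    using pos by (auto simp: positive_op_compact_resolvent_def compact_resolvent_def)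
  define g where "g x = x - inv_op x - z *\<^sub>C inv_op x" for x
  have "bounded_linear g"
    unfolding g_def
    by (intro bounded_linear_sub bounded_linear_ident bounded_linear_inv_op
        bounded_linear_compose[OF bounded_linear_scaleC])
  then have "bounded (g ` S)" using assms by (rule bounded_linear_image[rotated])
  moreover have "inv_op x = resolvent D A z (g x)" for x
    using resolvent_left[OF z inv_op_in[of x]] by (simp add: g_def op_inv_op)
  then have "inv_op ` S = resolvent D A z ` (g ` S)" by (auto simp: image_iff)
  ultimately show ?thesis using cpt by simp
qed

text \<open>Trades the unbounded eigenvalue equation for one in a bounded operator. Closedness of
  eigenspaces follows, and eigenvectors of \<open>inv_op\<close> become eigenvectors of
  \<open>A\<close>.\<close>

lemma eigenspace_iff:
  assumes "l \<noteq> - 1"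
  shows "u \<in> eigenspace D A l \<longleftrightarrow> (1 + l) *\<^sub>R inv_op u = u"
proof
  assume "u \<in> eigenspace D A l"
  then have "u \<in> D" "A u + u = (1 + l) *\<^sub>R u" by (auto simp: eigenspace_def algebra_simps)
  then show "(1 + l) *\<^sub>R inv_op u = u" using inv_op_op[of u] by (simp add: inv_op_scaleR)
next
  assume u: "(1 + l) *\<^sub>R inv_op u = u"
  then have "A u = (1 + l) *\<^sub>R (u - inv_op u)"
    using op_scaleR[OF inv_op_in[of u], of "1 + l"] by (simp add: op_inv_op)
  also have "\<dots> = l *\<^sub>R u" using u by (simp add: scaleR_diff_right scaleR_left_distrib)
  finally show "u \<in> eigenspace D A l"
    using csubspace_scaleR[OF op_domain inv_op_in[of u], of "1 + l"] u by (simp add: eigenspace_def)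
qed

section \<open>Eigenspaces: closed, mutually orthogonal, total\<close>

lemma csubspace_eigenspace: "csubspace (eigenspace D A l)"
  using op_domain op_zero
  by (auto simp: csubspace_def eigenspace_def op_add op_scaleC scaleR_add_right scaleC_scaleR_commute)

lemma closed_eigenspace:
  assumes "l \<in> eigenvalues D A"
  shows "closed (eigenspace D A l)"
proof -
  have "eigenspace D A l = {u. (1 + l) *\<^sub>R inv_op u = u}"
    using eigenvalues_nonneg[OF assms] eigenspace_iff[of l] by auto
  then show ?thesis
    by (simp add: closed_Collect_eq linear_continuous_on bounded_linear_inv_op
        bounded_linear_scaleR_right bounded_linear_compose continuous_intros)
qed

lemma eigenspace_orthogonal:
  assumes "u \<in> eigenspace D A k" "v \<in> eigenspace D A l" "k \<noteq> l"
  shows "cinner u v = 0"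
proof -
  have "cinner (A u) v = cinner u (A v)"
    using assms by (intro op_symmetric) (auto simp: eigenspace_def)
  then have "of_real k * cinner u v = of_real l * cinner u v"
    using assms by (simp add: eigenspace_def cinner_scaleR_left cinner_scaleR_right)
  then show ?thesis using assms(3) by simp
qed

text \<open>On the orthogonal complement \<open>M\<close> of all eigenvectors, a maximising sequence for \<open>norm (inv_op v)\<close>
  would by compactness produce an eigenvector of \<open>inv_op\<^sup>2\<close>, hence one of \<open>inv_op\<close> and of \<open>A\<close>,
  lying in \<open>M\<close>.\<close>

lemma eigenvectors_total:
  assumes v: "\<And>l e. l \<in> eigenvalues D A \<Longrightarrow> e \<in> eigenspace D A l \<Longrightarrow> cinner e v = 0"
  shows "v = 0"
proof (rule ccontr)
  assume "v \<noteq> 0"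
  interpret T: bounded_linear inv_op by (rule bounded_linear_inv_op)
  define M where "M = {v. \<forall>l\<in>eigenvalues D A. \<forall>e\<in>eigenspace D A l. cinner e v = 0}"
  have M_add: "x + y \<in> M" if "x \<in> M" "y \<in> M" for x y
    using that by (simp add: M_def cinner_add_right)
  have M_scaleR: "r *\<^sub>R x \<in> M" if "x \<in> M" for x r
    using that by (simp add: M_def cinner_scaleR_right)
  \<comment> \<open>Symmetry moves \<open>inv_op\<close> onto the eigenvector \<open>e\<close>,
    where it acts as division by \<open>1 + l\<close>.\<close>
  have M_inv: "inv_op x \<in> M" if "x \<in> M" for x
    unfolding M_def
  proof (clarify)
    fix l e assume l: "l \<in> eigenvalues D A" and e: "e \<in> eigenspace D A l"
    have l0: "1 + l \<noteq> 0" using eigenvalues_nonneg[OF l] by simp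
    then have "(1 + l) *\<^sub>R inv_op e = e" using e eigenspace_iff[of l] by auto
    then have "of_real (1 + l) * cinner (inv_op e) x = cinner e x" by (metis cinner_scaleR_left)
    also have "cinner e x = 0" using that l e by (auto simp: M_def)
    finally show "cinner e (inv_op x) = 0" using l0 by (metis inv_op_symmetric mult_eq_0_iff of_real_eq_0_iff)
  qed
  have M_closed: "x \<in> M" if "\<And>n. X n \<in> M" "X \<longlonglongrightarrow> x" for X x
    unfolding M_def
  proof (clarify)
    fix l e assume le: "l \<in> eigenvalues D A" "e \<in> eigenspace D A l"
    have "(\<lambda>n. cinner e (X n)) \<longlonglongrightarrow> cinner e x"
      using that(2) by (rule bounded_linear.tendsto[OF bounded_linear_cinner_right])
    moreover have "cinner e (X n) = 0" for n using that(1) le by (auto simp: M_def)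
    ultimately show "cinner e x = 0" by (simp add: LIMSEQ_const_iff)
  qed
  define W where "W = {w \<in> M. norm w = 1}"
  have "v \<in> M" using v by (auto simp: M_def)
  then have w0: "v /\<^sub>R norm v \<in> W" using M_scaleR \<open>v \<noteq> 0\<close> by (simp add: W_def)
  define m where "m = (SUP w\<in>W. norm (inv_op w))"
  obtain K where K: "\<And>x. norm (inv_op x) \<le> norm x * K" using T.bounded by blast
  have bdd: "bdd_above ((\<lambda>w. norm (inv_op w)) ` W)"
    using K by (intro bdd_aboveI[of _ K]) (auto simp: W_def, metis mult_1)
  have le_m: "norm (inv_op w) \<le> m" if "w \<in> W" for w
    unfolding m_def using bdd that by (rule cSUP_upper[rotated])
  have m_bound: "norm (inv_op x) \<le> m * norm x" if "x \<in> M" for x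
  proof (cases "x = 0")
    case False
    then have "norm (inv_op (x /\<^sub>R norm x)) \<le> m" using that M_scaleR by (intro le_m) (auto simp: W_def)
    then show ?thesis using False by (simp add: inv_op_scaleR field_simps)
  qed simp
  have inj: "x = 0" if "inv_op x = 0" for x using op_inv_op[of x] that op_zero by simp
  have "0 < norm (inv_op (v /\<^sub>R norm v))" using inj[of "v /\<^sub>R norm v"] \<open>v \<noteq> 0\<close> by auto
  then have m_pos: "m > 0" using le_m[OF w0] by linarith
  have "\<exists>w\<in>W. m - e < norm (inv_op w)" if "e > 0" for e
  proof -
    have "m - e < (SUP w\<in>W. norm (inv_op w))" using that by (simp add: m_def)
    then show ?thesis using bdd w0 by (subst (asm) less_cSUP_iff) auto
  qed
  then have "\<forall>n. \<exists>w\<in>W. m - inverse (real (Suc n)) < norm (inv_op w)" by simp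
  then obtain X where X: "\<And>n. X n \<in> W" "\<And>n. m - inverse (real (Suc n)) < norm (inv_op (X n))"
    by metis
  have lim_m: "(\<lambda>n. norm (inv_op (X n))) \<longlonglongrightarrow> m"
  proof (rule real_tendsto_sandwich)
    have "(\<lambda>n. m - inverse (real (Suc n))) \<longlonglongrightarrow> m - 0"
      by (intro tendsto_intros LIMSEQ_inverse_real_of_nat)
    then show "(\<lambda>n. m - inverse (real (Suc n))) \<longlonglongrightarrow> m" by simp
  qed (use X le_m less_imp_le[OF X(2)] in auto)
  define Y where "Y n = inv_op (inv_op (X n)) - m\<^sup>2 *\<^sub>R X n" for n
  have Ysq: "(norm (Y n))\<^sup>2 \<le> 2 * m ^ 4 - 2 * m\<^sup>2 * (norm (inv_op (X n)))\<^sup>2" for n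
  proof -
    let ?t = "inv_op (X n)"
    have Xn: "X n \<in> M" "norm (X n) = 1" using X(1)[of n] by (auto simp: W_def)
    have "norm (inv_op ?t) \<le> m * norm ?t" using Xn M_inv m_bound by blast
    also have "\<dots> \<le> m * m" using m_bound[OF Xn(1)] Xn(2) m_pos by simp
    finally have "(norm (inv_op ?t))\<^sup>2 \<le> (m * m)\<^sup>2" by (simp add: power_mono)
    also have "(m * m)\<^sup>2 = m ^ 4" by (simp add: power2_eq_square power4_eq_xxxx)
    finally have "(norm (inv_op ?t))\<^sup>2 \<le> m ^ 4" .
    moreover have "Re (cinner (inv_op ?t) (X n)) = (norm ?t)\<^sup>2"
      by (simp only: inv_op_symmetric[of ?t] Re_cinner_self)
    ultimately show ?thesis
      using Xn by (simp add: Y_def norm_diff_square cinner_scaleR_right power_mult_distrib)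
  qed
  have "(\<lambda>n. 2 * m ^ 4 - 2 * m\<^sup>2 * (norm (inv_op (X n)))\<^sup>2) \<longlonglongrightarrow> 2 * m ^ 4 - 2 * m\<^sup>2 * m\<^sup>2"
    by (intro tendsto_intros lim_m)
  then have "(\<lambda>n. 2 * m ^ 4 - 2 * m\<^sup>2 * (norm (inv_op (X n)))\<^sup>2) \<longlonglongrightarrow> 0"
    by (simp add: power2_eq_square power4_eq_xxxx)
  then have "(\<lambda>n. (norm (Y n))\<^sup>2) \<longlonglongrightarrow> 0"
    by (rule real_tendsto_sandwich[rotated 3, OF _ _ _ tendsto_const]) (use Ysq in auto)
  then have "(\<lambda>n. sqrt ((norm (Y n))\<^sup>2)) \<longlonglongrightarrow> sqrt 0" by (rule tendsto_real_sqrt)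
  then have Y0: "Y \<longlonglongrightarrow> 0" by (simp add: tendsto_norm_zero_iff)
  have "bounded (range X)"
    by (rule boundedI[of _ 1]) (use X(1) in \<open>auto simp: W_def\<close>)
  then have cpt: "seq_compact (closure (inv_op ` range X))"
    by (intro compact_imp_seq_compact compact_inv_op)
  have in_cpt: "\<forall>n. inv_op (X n) \<in> closure (inv_op ` range X)"
    using closure_subset[of "inv_op ` range X"] by auto
  obtain q r where r: "strict_mono (r :: nat \<Rightarrow> nat)" and q: "((\<lambda>n. inv_op (X n)) \<circ> r) \<longlonglongrightarrow> q"
    by (rule seq_compactE[OF cpt in_cpt])
  \<comment> \<open>Compactness makes only \<open>inv_op (X (r n))\<close> converge; solving the
    residual for \<open>X (r n)\<close>, which needs \<open>m > 0\<close>, makes the vectors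
    themselves converge.\<close>
  have Xr: "(\<lambda>n. X (r n)) \<longlonglongrightarrow> (inv_op q - 0) /\<^sub>R m\<^sup>2"
  proof -
    have "(\<lambda>n. Y (r n)) \<longlonglongrightarrow> 0" using LIMSEQ_subseq_LIMSEQ[OF Y0 r] by (simp add: o_def)
    moreover have "(\<lambda>n. inv_op (inv_op (X (r n)))) \<longlonglongrightarrow> inv_op q"
      using T.tendsto[OF q] by (simp add: o_def)
    ultimately have "(\<lambda>n. (inv_op (inv_op (X (r n))) - Y (r n)) /\<^sub>R m\<^sup>2) \<longlonglongrightarrow> (inv_op q - 0) /\<^sub>R m\<^sup>2"
      by (intro tendsto_intros)
    then show ?thesis using m_pos by (simp add: Y_def)
  qed
  define x where "x = (inv_op q - 0) /\<^sub>R m\<^sup>2"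
  have Xx: "(\<lambda>n. X (r n)) \<longlonglongrightarrow> x" using Xr by (simp add: x_def)
  have xM: "x \<in> M" using M_closed[OF _ Xx] X(1) by (auto simp: W_def)
  have "(\<lambda>n. norm (X (r n))) \<longlonglongrightarrow> norm x" using Xx by (rule tendsto_norm)
  then have "norm x = 1" using X(1) by (simp add: W_def LIMSEQ_const_iff)
  then have x0: "x \<noteq> 0" by auto
  have "q = inv_op x"
    using T.tendsto[OF Xx] q by (intro LIMSEQ_unique[of "\<lambda>n. inv_op (X (r n))"]) (simp_all add: o_def)
  then have xx: "inv_op (inv_op x) = m\<^sup>2 *\<^sub>R x" using m_pos by (simp add: x_def)
  \<comment> \<open>An eigenvector of \<open>inv_op\<close> for \<open>c\<close> is one of
    \<open>A\<close> for \<open>1 / c - 1\<close>; inside \<open>M\<close> it would be orthogonal to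
    itself.\<close>
  have no_eig: "e = 0" if "e \<in> M" "inv_op e = c *\<^sub>R e" "c \<noteq> 0" for e c
  proof (rule ccontr)
    assume e0: "e \<noteq> 0"
    have e: "e \<in> eigenspace D A (1 / c - 1)"
      using that by (subst eigenspace_iff) auto
    then have "1 / c - 1 \<in> eigenvalues D A" using e0 by (auto simp: eigenvalues_def)
    then have "cinner e e = 0" using e \<open>e \<in> M\<close> by (auto simp: M_def)
    then show False using e0 by (simp add: cinner_self)
  qed
  \<comment> \<open>The square of \<open>inv_op\<close> minus \<open>m\<^sup>2\<close> factors into
    \<open>inv_op - m\<close> and \<open>inv_op + m\<close>, so this vector would be an eigenvector
    for \<open>m\<close>. Once it is zero, \<open>x\<close> is an eigenvector for
    \<open>- m\<close>, which is excluded in the same way.\<close>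
  have "inv_op x + m *\<^sub>R x = 0"
  proof (rule no_eig[of _ m])
    show "inv_op x + m *\<^sub>R x \<in> M" using xM M_inv M_add M_scaleR by blast
    show "inv_op (inv_op x + m *\<^sub>R x) = m *\<^sub>R (inv_op x + m *\<^sub>R x)"
      by (simp add: inv_op_add inv_op_scaleR xx scaleR_add_right power2_eq_square add.commute)
  qed (use m_pos in simp)
  then have "inv_op x = (- m) *\<^sub>R x" by (simp add: add_eq_0_iff)
  then show False using no_eig[OF xM _ , of "- m"] m_pos x0 by auto
qed

end

section \<open>Functional calculus\<close>

lemma scale_norm_nonneg: "0 \<le> scale_norm D A r u"
  by (simp add: scale_norm_def)

context
  fixes D :: "'a::complex_hilbert set" and A :: "'a \<Rightarrow> 'a"
  assumes pos: "positive_op_compact_resolvent D A"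
begin

private abbreviation (input) "E \<equiv> eigenvalues D A"
private abbreviation (input) "Pr l \<equiv> orth_proj (eigenspace D A l)"

section \<open>Eigenprojections and the expansion they generate\<close>

lemmas eigenspace_closed_subspace = csubspace_eigenspace[OF pos] closed_eigenspace[OF pos]
lemmas Pr_in = orth_proj_in[OF eigenspace_closed_subspace]
  and Pr_add = orth_proj_add[OF eigenspace_closed_subspace]
  and Pr_scaleC = orth_proj_scaleC[OF eigenspace_closed_subspace]
  and Pr_id = orth_proj_id[OF eigenspace_closed_subspace]
  and Pr_zero = orth_proj_zero[OF eigenspace_closed_subspace]
  and Pr_bounded_linear = bounded_linear_orth_proj[OF eigenspace_closed_subspace]
  and cinner_Pr_left = cinner_orth_proj_left[OF eigenspace_closed_subspace]
  and Pr_orthogonal = orth_proj_orthogonal[OF eigenspace_closed_subspace]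

lemma cinner_Pr_Pr: "k \<in> E \<Longrightarrow> l \<in> E \<Longrightarrow> k \<noteq> l \<Longrightarrow> cinner (Pr k u) (Pr l v) = 0"
  using Pr_in eigenspace_orthogonal[OF pos] by blast

lemma Pr_Pr: "k \<in> E \<Longrightarrow> l \<in> E \<Longrightarrow> Pr k (Pr l u) = (if k = l then Pr l u else 0)"
  using Pr_in[of l u] eigenspace_orthogonal[OF pos, of _ k "Pr l u" l]
  by (auto intro: Pr_id Pr_zero)

lemma Pr_scaleR: "l \<in> E \<Longrightarrow> Pr l (r *\<^sub>R u) = r *\<^sub>R Pr l u"
  using Pr_scaleC[of l "of_real r" u] by (simp add: scaleC_of_real)

lemma Pr_diff: "l \<in> E \<Longrightarrow> Pr l (u - v) = Pr l u - Pr l v"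
  using Pr_add[of l "u - v" v] by (simp add: algebra_simps)

text \<open>A finite partial sum \<open>s\<close> satisfies
  \<open>(norm s)\<^sup>2 = Re (cinner u s)\<close>, so Cauchy-Schwarz bounds it by
  \<open>norm u\<close>. The existence of the expansion rests on this.\<close>

lemma bessel: "(\<lambda>l. (norm (Pr l u))\<^sup>2) summable_on E"
proof (rule nonneg_bdd_above_summable_on)
  show "bdd_above (sum (\<lambda>l. (norm (Pr l u))\<^sup>2) ` {F. F \<subseteq> E \<and> finite F})"
  proof (rule bdd_aboveI[of _ "(norm u)\<^sup>2"], clarify)
    fix F assume F: "F \<subseteq> E" "finite F"
    define s where "s = (\<Sum>l\<in>F. Pr l u)"
    have s: "(norm s)\<^sup>2 = (\<Sum>l\<in>F. (norm (Pr l u))\<^sup>2)"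
      unfolding s_def using F by (intro norm_sum_orthogonal cinner_Pr_Pr) auto
    also have "\<dots> = (\<Sum>l\<in>F. Re (cinner u (Pr l u)))"
    proof (intro sum.cong refl)
      fix l assume "l \<in> F"
      then show "(norm (Pr l u))\<^sup>2 = Re (cinner u (Pr l u))"
        using cinner_Pr_left[of l u u] F Re_cinner_commute[of u "Pr l u"]
        by (simp add: Re_cinner_self subset_iff)
    qed
    also have "\<dots> = Re (cinner u s)" by (simp add: s_def cinner_sum_right)
    also have "\<dots> \<le> norm u * norm s" by (rule Re_cinner_le)
    finally have "norm s * norm s \<le> norm u * norm s" by (simp add: power2_eq_square)
    then have "norm s \<le> norm u" by (cases "s = 0") auto
    then show "(\<Sum>l\<in>F. (norm (Pr l u))\<^sup>2) \<le> (norm u)\<^sup>2" by (simp add: s[symmetric] power_mono)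
  qed
qed simp

lemma Pr_has_sum:
  assumes x: "(x has_sum S) E" and k: "k \<in> E"
    and zero: "\<And>l. l \<in> E \<Longrightarrow> l \<noteq> k \<Longrightarrow> Pr k (x l) = 0"
  shows "Pr k S = Pr k (x k)"
proof -
  have "((\<lambda>l. Pr k (x l)) has_sum Pr k S) E"
    by (rule has_sum_bounded_linear[OF Pr_bounded_linear[OF k] x])
  moreover have "((\<lambda>l. Pr k (x l)) has_sum Pr k (x k)) E"
    by (rule has_sum_finite_neutralI[of "{k}"]) (use zero k in auto)
  ultimately show ?thesis by (rule has_sum_unique)
qed

text \<open>Bessel makes the sum exist; what it misses of \<open>u\<close> is orthogonal to every
  eigenvector and vanishes by totality.\<close>

lemma eigen_expansion: "((\<lambda>l. Pr l u) has_sum u) E"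
proof -
  have "(\<lambda>l. Pr l u) summable_on E"
    by (rule summable_on_orthogonal) (auto intro: cinner_Pr_Pr bessel)
  then have S: "((\<lambda>l. Pr l u) has_sum (infsum (\<lambda>l. Pr l u) E)) E" by simp
  have "u - infsum (\<lambda>l. Pr l u) E = 0"
  proof (rule eigenvectors_total[OF pos])
    fix l e assume l: "l \<in> E" and e: "e \<in> eigenspace D A l"
    have "Pr l (infsum (\<lambda>l. Pr l u) E) = Pr l u"
      using Pr_has_sum[OF S l] l by (simp add: Pr_Pr)
    then have "Pr l (u - infsum (\<lambda>l. Pr l u) E) = 0" using l by (simp add: Pr_diff)
    then show "cinner e (u - infsum (\<lambda>l. Pr l u) E) = 0"
      using Pr_orthogonal[OF l e, of "u - infsum (\<lambda>l. Pr l u) E"] by simp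
  qed
  then show ?thesis using S by simp
qed

text \<open>Reduces operator identities to one eigenspace at a time, where functions of the operator
  are multiplication by a number.\<close>

lemma eigen_expansion_eqI:
  assumes "\<And>l. l \<in> E \<Longrightarrow> Pr l u = Pr l v"
  shows "u = v"
proof -
  have "((\<lambda>l. Pr l v) has_sum u) E"
    using eigen_expansion[of u] assms by (simp cong: has_sum_cong)
  then show ?thesis using eigen_expansion[of v] by (rule has_sum_unique)
qed

lemma parseval: "((\<lambda>l. (norm (Pr l u))\<^sup>2) has_sum (norm u)\<^sup>2) E"
  by (rule has_sum_orthogonal_norm) (auto intro: cinner_Pr_Pr eigen_expansion)

lemma cinner_expansion: "((\<lambda>l. cinner (Pr l u) (Pr l v)) has_sum cinner u v) E"
proof -
  have "((\<lambda>l. cinner (Pr l u) v) has_sum cinner u v) E"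
    by (rule has_sum_bounded_linear[OF bounded_bilinear.bounded_linear_left
          [OF bounded_bilinear_cinner] eigen_expansion])
  then show ?thesis by (rule has_sum_cong[THEN iffD1, rotated]) (simp add: cinner_Pr_left[symmetric])
qed

section \<open>Domains and values of functions of the operator\<close>

lemma spectral_dom_mono:
  assumes u: "u \<in> spectral_dom D A g"
    and le: "\<And>l. l \<in> E \<Longrightarrow> \<bar>f l\<bar> * norm (Pr l v) \<le> \<bar>g l\<bar> * norm (Pr l u)"
  shows "v \<in> spectral_dom D A f"
proof -
  have le2: "(f l)\<^sup>2 * (norm (Pr l v))\<^sup>2 \<le> (g l)\<^sup>2 * (norm (Pr l u))\<^sup>2" if "l \<in> E" for l
    using power_mono[OF le[OF that], of 2] by (simp add: power_mult_distrib)
  show ?thesis using u le2 unfolding spectral_dom_def mem_Collect_eq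
    by (rule summable_on_comparison_test) auto
qed

text \<open>Comparison with the constant function \<open>C\<close>, whose domain is the whole space
  by Bessel; hence \<open>u\<close> may be any vector.\<close>

lemma spectral_dom_bounded:
  assumes "\<And>l. l \<in> E \<Longrightarrow> \<bar>f l\<bar> * norm (Pr l v) \<le> C * norm (Pr l u)"
  shows "v \<in> spectral_dom D A f"
proof (rule spectral_dom_mono)
  show "u \<in> spectral_dom D A (\<lambda>_. C)"
    using bessel by (simp add: spectral_dom_def summable_on_cmult_right)
  show "\<bar>f l\<bar> * norm (Pr l v) \<le> \<bar>C\<bar> * norm (Pr l u)" if "l \<in> E" for l
    using assms[OF that] by (smt (verit) mult_right_mono norm_ge_zero)
qed

lemma spectral_fun_has_sum:
  assumes "u \<in> spectral_dom D A f"
  shows "((\<lambda>l. f l *\<^sub>R Pr l u) has_sum spectral_fun D A f u) E"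
proof -
  have "(\<lambda>l. f l *\<^sub>R Pr l u) summable_on E"
  proof (rule summable_on_orthogonal)
    show "(\<lambda>l. (norm (f l *\<^sub>R Pr l u))\<^sup>2) summable_on E"
      using assms by (simp add: spectral_dom_def power_mult_distrib)
  qed (simp add: cinner_Pr_Pr cinner_scaleR_left cinner_scaleR_right)
  then show ?thesis by (simp add: spectral_fun_def)
qed

lemma spectral_fun_norm_has_sum:
  assumes "u \<in> spectral_dom D A f"
  shows "((\<lambda>l. (f l)\<^sup>2 * (norm (Pr l u))\<^sup>2) has_sum (norm (spectral_fun D A f u))\<^sup>2) E"
  using has_sum_orthogonal_norm[OF _ spectral_fun_has_sum[OF assms]]
  by (simp add: cinner_Pr_Pr cinner_scaleR_left cinner_scaleR_right power_mult_distrib)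

lemma Pr_spectral_fun:
  assumes "u \<in> spectral_dom D A f" "k \<in> E"
  shows "Pr k (spectral_fun D A f u) = f k *\<^sub>R Pr k u"
  using Pr_has_sum[OF spectral_fun_has_sum[OF assms(1)] assms(2)] assms(2)
  by (simp add: Pr_scaleR Pr_Pr)

lemma csubspace_spectral_dom: "csubspace (spectral_dom D A f)"
  unfolding csubspace_def
proof (intro conjI ballI allI)
  show "0 \<in> spectral_dom D A f"
    by (rule spectral_dom_bounded[of _ _ 0 0]) (use Pr_scaleR[of _ 0 0] in simp)
next
  fix u v assume u: "u \<in> spectral_dom D A f" and v: "v \<in> spectral_dom D A f"
  have "((\<lambda>l. 2 * ((f l)\<^sup>2 * (norm (Pr l u))\<^sup>2) + 2 * ((f l)\<^sup>2 * (norm (Pr l v))\<^sup>2))) summable_on E"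
    using u v unfolding spectral_dom_def by (intro summable_on_add summable_on_cmult_right) auto
  then show "u + v \<in> spectral_dom D A f"
    unfolding spectral_dom_def mem_Collect_eq
  proof (rule summable_on_comparison_test)
    fix l assume "l \<in> E"
    then have "(norm (Pr l (u + v)))\<^sup>2 \<le> 2 * (norm (Pr l u))\<^sup>2 + 2 * (norm (Pr l v))\<^sup>2"
      using parallelogram_law[of "Pr l u" "Pr l v"] zero_le_power2[of "norm (Pr l u - Pr l v)"]
      unfolding Pr_add[OF \<open>l \<in> E\<close>] by linarith
    then have "(f l)\<^sup>2 * (norm (Pr l (u + v)))\<^sup>2 \<le> (f l)\<^sup>2 * (2 * (norm (Pr l u))\<^sup>2 + 2 * (norm (Pr l v))\<^sup>2)"
      by (simp add: mult_left_mono)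
    then show "(f l)\<^sup>2 * (norm (Pr l (u + v)))\<^sup>2
        \<le> 2 * ((f l)\<^sup>2 * (norm (Pr l u))\<^sup>2) + 2 * ((f l)\<^sup>2 * (norm (Pr l v))\<^sup>2)"
      by (simp add: algebra_simps)
  qed simp
next
  fix c u assume u: "u \<in> spectral_dom D A f"
  then have "(\<lambda>l. (cmod c)\<^sup>2 * ((f l)\<^sup>2 * (norm (Pr l u))\<^sup>2)) summable_on E"
    unfolding spectral_dom_def by (intro summable_on_cmult_right) auto
  then show "c *\<^sub>C u \<in> spectral_dom D A f"
    unfolding spectral_dom_def mem_Collect_eq
    by (rule summable_on_cong[THEN iffD1, rotated])
       (simp add: Pr_scaleC norm_scaleC power_mult_distrib)
qed

lemma spectral_fun_add:
  assumes "u \<in> spectral_dom D A f" "v \<in> spectral_dom D A f"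
  shows "spectral_fun D A f (u + v) = spectral_fun D A f u + spectral_fun D A f v"
proof -
  have "u + v \<in> spectral_dom D A f" using csubspace_spectral_dom assms by (auto simp: csubspace_def)
  then show ?thesis
    using assms by - (rule eigen_expansion_eqI, simp add: Pr_spectral_fun Pr_add scaleR_add_right)
qed

lemma spectral_fun_scaleC:
  assumes "u \<in> spectral_dom D A f"
  shows "spectral_fun D A f (c *\<^sub>C u) = c *\<^sub>C spectral_fun D A f u"
proof -
  have "c *\<^sub>C u \<in> spectral_dom D A f" using csubspace_spectral_dom assms by (auto simp: csubspace_def)
  then show ?thesis
    using assms
    by - (rule eigen_expansion_eqI, simp add: Pr_spectral_fun Pr_scaleC scaleC_scaleR_commute)
qed

section \<open>Spectral projections\<close>

private abbreviation (input) "P \<equiv> spectral_proj D A"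

lemma Pr_spectral_proj: "l \<in> E \<Longrightarrow> Pr l (P N u) = indicator {0..N} l *\<^sub>R Pr l u"
  unfolding spectral_proj_def
  by (rule Pr_spectral_fun, rule spectral_dom_bounded[where C = 1 and u = u])
     (auto simp: indicator_def)

lemma spectral_proj_add: "P N (u + v) = P N u + P N v"
  by (rule eigen_expansion_eqI) (simp add: Pr_spectral_proj Pr_add scaleR_add_right)

lemma spectral_proj_scaleC: "P N (c *\<^sub>C u) = c *\<^sub>C P N u"
  by (rule eigen_expansion_eqI) (simp add: Pr_spectral_proj Pr_scaleC scaleC_scaleR_commute)

lemma spectral_proj_idem: "P N (P N u) = P N u"
  by (rule eigen_expansion_eqI) (simp add: Pr_spectral_proj indicator_def)

lemma spectral_proj_range: "v \<in> range (P N) \<Longrightarrow> P N v = v"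
  using spectral_proj_idem by auto

lemma spectral_proj_symmetric: "cinner (P N u) v = cinner u (P N v)"
proof (rule has_sum_unique)
  show "((\<lambda>l. cinner (Pr l (P N u)) (Pr l v)) has_sum cinner (P N u) v) E"
    by (rule cinner_expansion)
  show "((\<lambda>l. cinner (Pr l (P N u)) (Pr l v)) has_sum cinner u (P N v)) E"
    using cinner_expansion[of u "P N v"]
    by (rule has_sum_cong[THEN iffD1, rotated])
       (simp add: Pr_spectral_proj cinner_scaleR_left cinner_scaleR_right)
qed

lemma norm_spectral_proj_le: "norm (P N u) \<le> norm u"
proof -
  have "(norm (P N u))\<^sup>2 \<le> (norm u)\<^sup>2"
    by (rule has_sum_mono[OF parseval parseval]) (simp add: Pr_spectral_proj indicator_def)
  then show ?thesis by (rule power2_le_imp_le) simp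
qed

lemma bounded_linear_spectral_proj: "bounded_linear (P N)"
proof (rule bounded_linear_intro[where K = 1])
  show "P N (r *\<^sub>R u) = r *\<^sub>R P N u" for r u
    using spectral_proj_scaleC[of N "of_real r" u] by (simp add: scaleC_of_real)
qed (simp_all add: spectral_proj_add norm_spectral_proj_le)

lemma Pr_spectral_proj_compl:
  "l \<in> E \<Longrightarrow> Pr l (u - P N u) = indicator (- {0..N}) l *\<^sub>R Pr l u"
  by (simp add: Pr_diff Pr_spectral_proj indicator_def)

section \<open>Norms of the scale\<close>

context
  fixes r :: real
  assumes r: "0 \<le> r"
begin

private abbreviation (input) "X \<equiv> scale_space D A r"
private abbreviation (input) "nm \<equiv> scale_norm D A r"

lemma scale_weight_ge_1: "l \<in> E \<Longrightarrow> 1 \<le> (1 + l) powr r"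
  using eigenvalues_nonneg[OF pos] r by (simp add: ge_one_powr_ge_zero)

lemma csubspace_scale: "csubspace X"
  unfolding scale_space_def by (rule csubspace_spectral_dom)

lemma scale_diff: "u \<in> X \<Longrightarrow> v \<in> X \<Longrightarrow> u - v \<in> X"
  using csubspace_scale csubspace_diff by blast

lemma scale_norm_has_sum:
  "u \<in> X \<Longrightarrow> ((\<lambda>l. ((1 + l) powr r)\<^sup>2 * (norm (Pr l u))\<^sup>2) has_sum (nm u)\<^sup>2) E"
  unfolding scale_space_def scale_norm_def by (rule spectral_fun_norm_has_sum)

lemma scale_norm_triangle: "u \<in> X \<Longrightarrow> v \<in> X \<Longrightarrow> nm (u + v) \<le> nm u + nm v"
  unfolding scale_space_def scale_norm_def by (simp add: spectral_fun_add norm_triangle_ineq)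

lemma scale_norm_scaleC: "u \<in> X \<Longrightarrow> nm (c *\<^sub>C u) = cmod c * nm u"
  unfolding scale_space_def scale_norm_def by (simp add: spectral_fun_scaleC norm_scaleC)

lemma scale_norm_scaleR: "u \<in> X \<Longrightarrow> nm (s *\<^sub>R u) = \<bar>s\<bar> * nm u"
  using scale_norm_scaleC[of u "of_real s"] by (simp add: scaleC_of_real)

lemma norm_le_scale_norm:
  assumes "u \<in> X"
  shows "norm u \<le> nm u"
proof -
  have "(norm u)\<^sup>2 \<le> (nm u)\<^sup>2"
  proof (rule has_sum_mono[OF parseval scale_norm_has_sum[OF assms]])
    fix l assume "l \<in> E"
    then have "1 \<le> ((1 + l) powr r)\<^sup>2" using scale_weight_ge_1 by simp
    then show "(norm (Pr l u))\<^sup>2 \<le> ((1 + l) powr r)\<^sup>2 * (norm (Pr l u))\<^sup>2"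
      by (simp add: mult_le_cancel_right1)
  qed
  then show ?thesis by (rule power2_le_imp_le) (rule scale_norm_nonneg)
qed

text \<open>Up to the cutoff the weight is at most \<open>(1 + N) powr r\<close>. This bound grows
  with \<open>N\<close>, so it serves for membership only and never enters an estimate.\<close>

lemma spectral_proj_in_scale: "P N u \<in> X"
  unfolding scale_space_def
proof (rule spectral_dom_bounded[where C = "(1 + N) powr r" and u = u])
  fix l assume "l \<in> E"
  moreover have "(1 + l) powr r \<le> (1 + N) powr r" if "0 \<le> l" "l \<le> N"
    using that r by (intro powr_mono2) auto
  ultimately show "\<bar>(1 + l) powr r\<bar> * norm (Pr l (P N u)) \<le> (1 + N) powr r * norm (Pr l u)"
    by (auto simp: Pr_spectral_proj indicator_def mult_right_mono)
qed

text \<open>Removing terms from the weighted Parseval sum can only decrease it. That the bound is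
  free of \<open>N\<close> is what uniform convergence relies on.\<close>

lemma scale_norm_spectral_proj_compl_le:
  assumes "u \<in> X"
  shows "nm (u - P N u) \<le> nm u"
proof -
  have "u - P N u \<in> X" using assms spectral_proj_in_scale scale_diff by blast
  then have "(nm (u - P N u))\<^sup>2 \<le> (nm u)\<^sup>2"
    by (rule has_sum_mono[OF scale_norm_has_sum scale_norm_has_sum[OF assms]])
       (simp add: Pr_spectral_proj_compl indicator_def)
  then show ?thesis by (rule power2_le_imp_le) (rule scale_norm_nonneg)
qed

text \<open>A finite set \<open>F\<close> of eigenvalues carries all but \<open>e\<^sup>2\<close> of
  the weighted Parseval sum, and a cutoff above \<open>F\<close> discards at most the rest.\<close>

lemma spectral_proj_tendsto:
  assumes u: "u \<in> X"
  shows "((\<lambda>N. nm (u - P N u)) \<longlongrightarrow> 0) at_top"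
proof (rule tendstoI)
  fix e :: real assume e: "e > 0"
  define a where "a l = ((1 + l) powr r)\<^sup>2 * (norm (Pr l u))\<^sup>2" for l
  have a: "(a has_sum (nm u)\<^sup>2) E" unfolding a_def by (rule scale_norm_has_sum[OF u])
  \<comment> \<open>Half of \<open>e\<^sup>2\<close>, because the finite approximation is only
    non-strict.\<close>
  have "e\<^sup>2 / 2 > 0" using e by simp
  from has_sum_finite_approximation[OF a this] obtain F where F: "finite F" "F \<subseteq> E"
    and "dist (sum a F) ((nm u)\<^sup>2) \<le> e\<^sup>2 / 2" by blast
  moreover have "0 < e\<^sup>2" using e by simp
  ultimately have small: "(nm u)\<^sup>2 - sum a F < e\<^sup>2" unfolding dist_real_def by linarith
  have tail: "(a has_sum ((nm u)\<^sup>2 - sum a F)) (E - F)"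
    using a F by (intro has_sum_Diff) auto
  have "nm (u - P N u) < e" if N: "\<forall>l\<in>F. l \<le> N" for N
  proof -
    have "u - P N u \<in> X" using u spectral_proj_in_scale scale_diff by blast
    from scale_norm_has_sum[OF this] tail have "(nm (u - P N u))\<^sup>2 \<le> (nm u)\<^sup>2 - sum a F"
    proof (rule has_sum_mono_neutral)
      fix l assume "l \<in> E - (E - F)"
      then show "((1 + l) powr r)\<^sup>2 * (norm (Pr l (u - P N u)))\<^sup>2 \<le> 0"
        using N F eigenvalues_nonneg[OF pos, of l] by (auto simp: Pr_spectral_proj_compl)
    qed (auto simp: a_def Pr_spectral_proj_compl indicator_def)
    then have "(nm (u - P N u))\<^sup>2 < e\<^sup>2" using small by simp
    then show ?thesis by (rule power2_less_imp_less) (use e in simp)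
  qed
  moreover have "\<forall>\<^sub>F N in at_top. \<forall>l\<in>F. l \<le> N"
    using F(1) by (simp add: eventually_ball_finite eventually_ge_at_top)
  ultimately show "\<forall>\<^sub>F N in at_top. dist (nm (u - P N u)) 0 < e"
    by (auto simp: scale_norm_nonneg elim!: eventually_mono)
qed

text \<open>Rescaling to norm one puts \<open>v\<close> into the set of the supremum. That supremum
  is real-valued and says something only when the set is bounded above, which
  \<open>bounded_from_scale\<close> ensures.\<close>

lemma scale_opnorm_bound:
  assumes B: "bounded_from_scale D A r B" and v: "v \<in> X"
  shows "norm (B v) \<le> scale_opnorm D A r B * nm v"
proof -
  obtain C where C: "\<And>u. u \<in> X \<Longrightarrow> norm (B u) \<le> C * nm u"
    using B by (auto simp: bounded_from_scale_def)
  have lin: "B (c *\<^sub>C u) = c *\<^sub>C B u" if "u \<in> X" for c u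
    using B that by (auto simp: bounded_from_scale_def clinear_on_def)
  show ?thesis
  proof (cases "nm v = 0")
    case True
    then show ?thesis using C[OF v] by simp
  next
    case False
    then have nv: "nm v > 0" using scale_norm_nonneg[of D A r v] by simp
    have "norm (B u) \<le> \<bar>C\<bar>" if "u \<in> X" "nm u \<le> 1" for u
    proof -
      have "norm (B u) \<le> C * nm u" by (rule C[OF that(1)])
      also have "\<dots> \<le> \<bar>C\<bar> * 1" using that scale_norm_nonneg by (intro mult_mono) auto
      finally show ?thesis by simp
    qed
    then have bdd: "bdd_above ((\<lambda>u. norm (B u)) ` {u \<in> X. nm u \<le> 1})"
      by (intro bdd_aboveI[of _ "\<bar>C\<bar>"]) auto
    let ?w = "inverse (nm v) *\<^sub>R v"
    have w: "?w \<in> X" using csubspace_scale v by (rule csubspace_scaleR)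
    have "nm ?w = 1" using scale_norm_scaleR[OF v] nv by simp
    then have "norm (B ?w) \<le> scale_opnorm D A r B"
      unfolding scale_opnorm_def using bdd w by (intro cSUP_upper) auto
    moreover have "B ?w = inverse (nm v) *\<^sub>R B v"
      using lin[OF v, of "of_real (inverse (nm v))"] by (simp only: scaleC_of_real)
    ultimately show ?thesis using nv by (simp add: field_simps)
  qed
qed

text \<open>Lets \<open>scale_opnorm_bound\<close> be applied to the differences in the continuity
  assumption.\<close>

lemma bounded_from_scale_diff:
  assumes B: "bounded_from_scale D A r B" and B': "bounded_from_scale D A r B'"
  shows "bounded_from_scale D A r (\<lambda>v. B v - B' v)"
proof -
  obtain C C' where "\<And>u. u \<in> X \<Longrightarrow> norm (B u) \<le> C * nm u" "\<And>u. u \<in> X \<Longrightarrow> norm (B' u) \<le> C' * nm u"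
    using B B' by (auto simp: bounded_from_scale_def)
  then have "norm (B u - B' u) \<le> (C + C') * nm u" if "u \<in> X" for u
    using that norm_triangle_ineq4[of "B u" "B' u"] by (simp add: distrib_right) (smt (verit))
  moreover have "clinear_on X (\<lambda>v. B v - B' v)"
    using B B' by (auto simp: bounded_from_scale_def clinear_on_def scaleC_diff_right)
  ultimately show ?thesis by (auto simp: bounded_from_scale_def)
qed

end

end

section \<open>Galerkin approximation\<close>

lemma norm_square_has_real_derivative:
  fixes w :: "real \<Rightarrow> 'a::complex_hilbert"
  assumes "(w has_vector_derivative d) (at t within S)"
  shows "((\<lambda>t. (norm (w t))\<^sup>2) has_real_derivative 2 * Re (cinner (w t) d)) (at t within S)"
proof -
  have "((\<lambda>t. cinner (w t) (w t)) has_vector_derivative cinner (w t) d + cinner d (w t)) (at t within S)"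
    by (rule bounded_bilinear.has_vector_derivative[OF bounded_bilinear_cinner assms assms])
  from bounded_linear.has_vector_derivative[OF bounded_linear_Re this] show ?thesis
    using Re_cinner_commute[of d "w t"]
    by (simp add: Re_cinner_self has_real_derivative_iff_has_vector_derivative)
qed

text \<open>At a point where the norm is maximal, integrating the derivative of its square from the
  zero of \<open>w\<close> gives \<open>m\<^sup>2 \<le> 2 K m (b - a)\<close>.\<close>

lemma norm_bound_from_energy:
  fixes w d :: "real \<Rightarrow> 'a::complex_hilbert"
  assumes deriv: "\<And>t. t \<in> {a..b} \<Longrightarrow> (w has_vector_derivative d t) (at t within {a..b})"
    and energy: "\<And>t. t \<in> {a..b} \<Longrightarrow> \<bar>Re (cinner (w t) (d t))\<bar> \<le> K * norm (w t)"
    and K: "0 \<le> K" and s: "s \<in> {a..b}" "w s = 0" and t: "t \<in> {a..b}"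
  shows "norm (w t) \<le> 2 * K * (b - a)"
proof -
  have "continuous_on {a..b} w"
    unfolding continuous_on_eq_continuous_within
    using deriv has_vector_derivative_continuous by blast
  then have "continuous_on {a..b} (\<lambda>t. norm (w t))" by (rule continuous_on_norm)
  \<comment> \<open>Using the square at a maximum avoids differentiating the norm, which may fail
    where \<open>w\<close> vanishes; the price is a factor 2.\<close>
  then obtain x where x: "x \<in> {a..b}" and max: "\<And>t. t \<in> {a..b} \<Longrightarrow> norm (w t) \<le> norm (w x)"
    using continuous_attains_sup[of "{a..b}" "\<lambda>t. norm (w t)"] s by (metis compact_Icc empty_iff)
  define m where "m = norm (w x)"
  have m0: "0 \<le> m" by (simp add: m_def)
  have "norm ((norm (w x))\<^sup>2 - (norm (w s))\<^sup>2) \<le> (2 * K * m) * norm (x - s)"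
  proof (rule field_differentiable_bound[of "{a..b}" "\<lambda>t. (norm (w t))\<^sup>2" "\<lambda>t. 2 * Re (cinner (w t) (d t))"])
    fix t assume t: "t \<in> {a..b}"
    show "((\<lambda>t. (norm (w t))\<^sup>2) has_real_derivative 2 * Re (cinner (w t) (d t))) (at t within {a..b})"
      by (rule norm_square_has_real_derivative[OF deriv[OF t]])
    have "K * norm (w t) \<le> K * m" unfolding m_def using max[OF t] K by (rule mult_left_mono)
    then show "norm (2 * Re (cinner (w t) (d t))) \<le> 2 * K * m" using energy[OF t] by simp
  qed (use x s in auto)
  also have "\<dots> \<le> (2 * K * m) * (b - a)" using x s K m0 by (intro mult_left_mono) auto
  also have "norm ((norm (w x))\<^sup>2 - (norm (w s))\<^sup>2) = m * m"
    by (simp add: s m_def power2_eq_square)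
  also have "(2 * K * m) * (b - a) = m * (2 * K * (b - a))" by (simp only: mult_ac)
  finally have "m * m \<le> m * (2 * K * (b - a))" .
  moreover have "0 \<le> 2 * K * (b - a)" using K x by simp
  ultimately have "m \<le> 2 * K * (b - a)" using m0 by (cases "m = 0") (auto simp: mult_le_cancel_left)
  then show ?thesis using max[OF t] by (simp add: m_def)
qed

text \<open>A finite subcover, with monotonicity to merge the finitely many thresholds. The value at
  \<open>x\<close> is asked for separately because the punctured filter does not see it. It serves
  both operator bounds and cutoffs \<open>N\<close>.\<close>

lemma compact_local_imp_uniform:
  fixes K :: "'b::topological_space set" and Q :: "'b \<Rightarrow> real \<Rightarrow> bool"
  assumes K: "compact K"
    and loc: "\<And>x. x \<in> K \<Longrightarrow> \<exists>M. Q x M \<and> (\<forall>\<^sub>F y in at x within K. Q y M)"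
    and mono: "\<And>y M M'. Q y M \<Longrightarrow> M \<le> M' \<Longrightarrow> Q y M'"
  obtains M where "\<And>y. y \<in> K \<Longrightarrow> Q y M"
proof -
  have "\<forall>x\<in>K. \<exists>T M. open T \<and> x \<in> T \<and> (\<forall>y\<in>T \<inter> K. Q y M)"
  proof
    fix x assume "x \<in> K"
    then obtain M T where "Q x M" "open T" "x \<in> T" "\<forall>y\<in>T. y \<noteq> x \<longrightarrow> y \<in> K \<longrightarrow> Q y M"
      using loc[of x] unfolding eventually_at_topological by blast
    then show "\<exists>T M. open T \<and> x \<in> T \<and> (\<forall>y\<in>T \<inter> K. Q y M)"
      by (intro exI[of _ T] exI[of _ M]) auto
  qed
  then obtain T M where T: "\<And>x. x \<in> K \<Longrightarrow> open (T x)" "\<And>x. x \<in> K \<Longrightarrow> x \<in> T x"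
    and M: "\<And>x y. x \<in> K \<Longrightarrow> y \<in> T x \<Longrightarrow> y \<in> K \<Longrightarrow> Q y (M x)"
    by (metis IntI)
  obtain F where F: "F \<subseteq> K" "finite F" "K \<subseteq> (\<Union>x\<in>F. T x)"
    by (rule compactE_image[OF K, of K T]) (use T in auto)
  \<comment> \<open>The sum of absolute values dominates every threshold and, unlike a maximum,
    makes sense for empty \<open>F\<close>.\<close>
  have "Q y (\<Sum>x\<in>F. \<bar>M x\<bar>)" if y: "y \<in> K" for y
  proof -
    obtain x where x: "x \<in> F" "y \<in> T x" using F y by blast
    then have "Q y (M x)" using M F y by blast
    moreover have "\<bar>M x\<bar> \<le> (\<Sum>x\<in>F. \<bar>M x\<bar>)" using F x by (intro member_le_sum) auto
    ultimately show ?thesis using mono abs_ge_self order_trans by blast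
  qed
  then show thesis by (rule that)
qed

section \<open>Estimates uniform in time and the error bound\<close>

context
  fixes D :: "'a::complex_hilbert set" and A :: "'a \<Rightarrow> 'a" and r :: real
  assumes pos: "positive_op_compact_resolvent D A" and r: "0 \<le> r"
begin

text \<open>Close to \<open>t\<close> the operators differ by at most 1 in norm, so the constant at
  \<open>t\<close> plus 1 works in a neighbourhood; compactness of \<open>I\<close> does the
  rest.\<close>

lemma continuous_opnorm_imp_uniform_bound:
  fixes I :: "real set"
  assumes I: "compact I"
    and bounded: "\<And>t. t \<in> I \<Longrightarrow> bounded_from_scale D A r (H t)"
    and cont: "\<And>t. t \<in> I \<Longrightarrow>
      ((\<lambda>t'. scale_opnorm D A r (\<lambda>v. H t' v - H t v)) \<longlongrightarrow> 0) (at t within I)"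
  obtains C where "0 \<le> C" "\<And>t v. t \<in> I \<Longrightarrow> v \<in> scale_space D A r \<Longrightarrow> norm (H t v) \<le> C * scale_norm D A r v"
proof -
  define Q where "Q t C \<longleftrightarrow> (\<forall>v\<in>scale_space D A r. norm (H t v) \<le> C * scale_norm D A r v)" for t C
  note nn = scale_norm_nonneg[of D A r]
  have mono: "Q t C'" if "Q t C" "C \<le> C'" for t C C'
    using that nn unfolding Q_def by (meson mult_right_mono order_trans)
  obtain C where C: "\<And>t. t \<in> I \<Longrightarrow> Q t C"
  proof (rule compact_local_imp_uniform[OF I, of Q])
    fix t assume t: "t \<in> I"
    obtain C0 where C0: "\<And>v. v \<in> scale_space D A r \<Longrightarrow> norm (H t v) \<le> C0 * scale_norm D A r v"
      using bounded[OF t] by (auto simp: bounded_from_scale_def)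
    have "\<forall>\<^sub>F t' in at t within I. Q t' (C0 + 1)"
      using tendstoD[OF cont[OF t] zero_less_one]
    proof (rule eventually_mono[OF eventually_conj])
      show "\<forall>\<^sub>F t' in at t within I. t' \<in> I" by (simp add: eventually_at_filter)
    next
      fix t' assume *: "dist (scale_opnorm D A r (\<lambda>v. H t' v - H t v)) 0 < 1 \<and> t' \<in> I"
      show "Q t' (C0 + 1)"
        unfolding Q_def
      proof
        fix v assume v: "v \<in> scale_space D A r"
        have "bounded_from_scale D A r (\<lambda>v. H t' v - H t v)"
          using * t bounded by (intro bounded_from_scale_diff[OF pos r]) auto
        then have "norm (H t' v - H t v) \<le> scale_opnorm D A r (\<lambda>v. H t' v - H t v) * scale_norm D A r v"
          using v by (intro scale_opnorm_bound[OF pos r])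
        also have "\<dots> \<le> 1 * scale_norm D A r v" using * nn by (intro mult_right_mono) auto
        finally show "norm (H t' v) \<le> (C0 + 1) * scale_norm D A r v"
          using C0[OF v] norm_triangle_sub[of "H t' v" "H t v"] by (simp add: distrib_right)
      qed
    qed
    moreover have "Q t (C0 + 1)" by (rule mono[of t C0]) (use C0 in \<open>auto simp: Q_def\<close>)
    ultimately show "\<exists>M. Q t M \<and> (\<forall>\<^sub>F y in at t within I. Q y M)" by blast
  qed (use mono in blast)+
  show thesis
  proof (rule that[of "\<bar>C\<bar>"])
    show "norm (H t v) \<le> \<bar>C\<bar> * scale_norm D A r v" if "t \<in> I" "v \<in> scale_space D A r" for t v
      using mono[OF C[OF that(1)] abs_ge_self] that(2) by (auto simp: Q_def)
  qed simp
qed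

text \<open>Half of \<open>e\<close> is spent on pointwise convergence at \<open>x\<close>, the
  other half on the distance from \<open>g y\<close> to \<open>g x\<close>, which the complementary
  projection does not increase. One cutoff thus serves a whole neighbourhood.\<close>

lemma spectral_proj_tendsto_uniform:
  fixes g :: "'b::topological_space \<Rightarrow> 'a"
  assumes K: "compact K" and g: "\<And>x. x \<in> K \<Longrightarrow> g x \<in> scale_space D A r"
    and cont: "\<And>x. x \<in> K \<Longrightarrow> ((\<lambda>y. scale_norm D A r (g y - g x)) \<longlongrightarrow> 0) (at x within K)"
    and e: "0 < e"
  shows "\<forall>\<^sub>F N in at_top. \<forall>x\<in>K. scale_norm D A r (g x - spectral_proj D A N (g x)) < e"
proof -
  let ?n = "scale_norm D A r" and ?P = "spectral_proj D A"
  define Q where "Q x M \<longleftrightarrow> (\<forall>N\<ge>M. ?n (g x - ?P N (g x)) < e)" for x M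
  obtain M where M: "\<And>x. x \<in> K \<Longrightarrow> Q x M"
  proof (rule compact_local_imp_uniform[OF K, of Q])
    fix x assume x: "x \<in> K"
    have "\<forall>\<^sub>F N in at_top. dist (?n (g x - ?P N (g x))) 0 < e / 2"
      using tendstoD[OF spectral_proj_tendsto[OF pos r g[OF x]], of "e / 2"] e by simp
    then obtain M where M: "\<And>N. N \<ge> M \<Longrightarrow> ?n (g x - ?P N (g x)) < e / 2"
      unfolding eventually_at_top_linorder by (auto simp: scale_norm_nonneg)
    have step: "Q y M" if y: "y \<in> K" "?n (g y - g x) < e / 2" for y
      unfolding Q_def
    proof (intro allI impI)
      fix N assume N: "N \<ge> M"
      let ?h = "g y - g x"
      have h: "?h \<in> scale_space D A r" using g x y scale_diff[OF pos r] by blast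
      have "g y - ?P N (g y) = (?h - ?P N ?h) + (g x - ?P N (g x))"
        using spectral_proj_add[OF pos, of N ?h "g x"] by simp
      then have "?n (g y - ?P N (g y)) \<le> ?n (?h - ?P N ?h) + ?n (g x - ?P N (g x))"
        using scale_norm_triangle[OF pos r, of "?h - ?P N ?h" "g x - ?P N (g x)"]
          scale_diff[OF pos r] spectral_proj_in_scale[OF pos r] h g[OF x] by metis
      also have "?n (?h - ?P N ?h) \<le> ?n ?h" by (rule scale_norm_spectral_proj_compl_le[OF pos r h])
      finally show "?n (g y - ?P N (g y)) < e" using y(2) M[OF N] by linarith
    qed
    have "?n (g x - g x) \<le> 0"
      using scale_norm_scaleR[OF pos r g[OF x], of 0] by simp
    then have "Q x M" using step[OF x] e by simp
    moreover have "\<forall>\<^sub>F y in at x within K. dist (?n (g y - g x)) 0 < e / 2 \<and> y \<in> K"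
      using tendstoD[OF cont[OF x], of "e / 2"] e
      by (intro eventually_conj) (auto simp: eventually_at_filter)
    then have "\<forall>\<^sub>F y in at x within K. Q y M"
      by (rule eventually_mono) (auto intro: step simp: scale_norm_nonneg)
    ultimately show "\<exists>M. Q x M \<and> (\<forall>\<^sub>F y in at x within K. Q y M)" by blast
  qed (auto simp: Q_def)
  then show ?thesis unfolding Q_def eventually_at_top_linorder by blast
qed

text \<open>The solution through \<open>v\<close> at time \<open>t\<close> has constant norm. Its
  derivative there is \<open>- \<i> H v\<close>, so differentiating the squared norm gives
  \<open>0 = 2 Im \<langle>v, H v\<rangle>\<close>. With \<open>a < b\<close> the derivative within
  the interval is unique, so the two computations may be equated.\<close>

lemma generator_form_real:
  assumes I: "a < b" "t \<in> {a..b}"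
    and unitary: "unitary_propagator {a..b} U"
    and sol: "schroedinger_solution {a..b} H (\<lambda>s. U s t v)"
  shows "Im (cinner v (H t v)) = 0"
proof -
  have Utt: "U t t v = v" using unitary I by (auto simp: unitary_propagator_def)
  obtain d where d: "((\<lambda>s. U s t v) has_vector_derivative d) (at t within {a..b})"
    and Hd: "\<i> *\<^sub>C d = H t v"
    using sol I Utt unfolding schroedinger_solution_def by force
  have "norm (U s t v) = norm v" if "s \<in> {a..b}" for s
  proof -
    have "cinner (U s t v) (U s t v) = cinner v v"
      using unitary I that unfolding unitary_propagator_def unitary_op_def by blast
    then have "(norm (U s t v))\<^sup>2 = (norm v)\<^sup>2" by (metis Re_cinner_self)
    then show ?thesis by simp
  qed
  then have "((\<lambda>s. (norm (U s t v))\<^sup>2) has_vector_derivative 0) (at t within {a..b})"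
    using I by (intro has_vector_derivative_transform[OF _ _ has_vector_derivative_const[of "(norm v)\<^sup>2"]]) auto
  moreover have "((\<lambda>s. (norm (U s t v))\<^sup>2) has_vector_derivative 2 * Re (cinner v d)) (at t within {a..b})"
    using norm_square_has_real_derivative[OF d]
    by (simp add: Utt has_real_derivative_iff_has_vector_derivative)
  ultimately have "0 = 2 * Re (cinner v d)"
    by (rule vector_derivative_unique_within_closed_interval[OF I(1), of t, unfolded box_real, OF I(2)])
  then show ?thesis by (simp add: Hd[symmetric] cinner_scaleC_right)
qed

text \<open>With \<open>w = \<phi> - P \<psi>\<close> and \<open>q = \<psi> - P \<psi>\<close> one has \<open>\<i> w' = P H (w - q)\<close>, and the term
  \<open>\<langle>w, H w\<rangle>\<close> is real, so only \<open>\<langle>w, H q\<rangle>\<close> drives the growth of the norm of \<open>w\<close>.\<close>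

lemma galerkin_error_bound:
  fixes N :: real
  defines "P \<equiv> spectral_proj D A N"
  assumes phi: "schroedinger_solution {a..b} (galerkin_hamiltonian D A H N) \<phi>"
      "\<And>t. t \<in> {a..b} \<Longrightarrow> \<phi> t \<in> range P"
    and psi: "schroedinger_solution {a..b} H \<psi>" "\<And>t. t \<in> {a..b} \<Longrightarrow> \<psi> t \<in> scale_space D A r"
    and init: "s \<in> {a..b}" "\<phi> s = P (\<psi> s)"
    and lin: "\<And>t. t \<in> {a..b} \<Longrightarrow> clinear_on (scale_space D A r) (H t)"
    and real: "\<And>t v. a < b \<Longrightarrow> t \<in> {a..b} \<Longrightarrow> v \<in> scale_space D A r \<Longrightarrow> Im (cinner v (H t v)) = 0"
    and C: "0 \<le> C" "\<And>t v. t \<in> {a..b} \<Longrightarrow> v \<in> scale_space D A r \<Longrightarrow>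
      norm (H t v) \<le> C * scale_norm D A r v"
    and \<delta>: "\<And>t. t \<in> {a..b} \<Longrightarrow> scale_norm D A r (\<psi> t - P (\<psi> t)) \<le> \<delta>"
    and t: "t \<in> {a..b}"
  shows "norm (\<phi> t - \<psi> t) \<le> (2 * C * (b - a) + 1) * \<delta>"
proof -
  let ?X = "scale_space D A r"
  interpret P: bounded_linear P unfolding P_def by (rule bounded_linear_spectral_proj[OF pos])
  have PX: "P v \<in> ?X" for v unfolding P_def by (rule spectral_proj_in_scale[OF pos r])
  have Pr: "P v = v" if "v \<in> range P" for v
    using that unfolding P_def by (rule spectral_proj_range[OF pos])
  have Pphi: "P (\<phi> t) = \<phi> t" if "t \<in> {a..b}" for t by (rule Pr[OF phi(2)[OF that]])
  then have phiX: "\<phi> t \<in> ?X" if "t \<in> {a..b}" for t by (metis PX that)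
  define w where "w t = \<phi> t - P (\<psi> t)" for t
  define q where "q t = \<psi> t - P (\<psi> t)" for t
  have wX: "w t \<in> ?X" and qX: "q t \<in> ?X" if "t \<in> {a..b}" for t
    using that phiX psi(2) PX unfolding w_def q_def by (auto intro: scale_diff[OF pos r])
  have Pw: "P (w t) = w t" if "t \<in> {a..b}" for t
    by (simp add: w_def P.diff Pphi[OF that] Pr[OF rangeI])
  have "\<exists>d. (w has_vector_derivative d) (at t within {a..b})
      \<and> \<bar>Re (cinner (w t) d)\<bar> \<le> C * \<delta> * norm (w t)" if t: "t \<in> {a..b}" and ab: "a < b" for t
  proof -
    obtain d1 where d1: "(\<phi> has_vector_derivative d1) (at t within {a..b})" "\<i> *\<^sub>C d1 = P (H t (\<phi> t))"
      using phi(1) t Pphi[OF t]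
      unfolding schroedinger_solution_def galerkin_hamiltonian_def P_def[symmetric] by force
    obtain d2 where d2: "(\<psi> has_vector_derivative d2) (at t within {a..b})" "\<i> *\<^sub>C d2 = H t (\<psi> t)"
      using psi(1) t unfolding schroedinger_solution_def by blast
    have dw: "(w has_vector_derivative (d1 - P d2)) (at t within {a..b})"
      unfolding w_def by (intro has_vector_derivative_diff d1 P.has_vector_derivative d2)
    \<comment> \<open>Stated as an equality of sums, so that additivity of \<open>H t\<close> on the
      scale applies directly.\<close>
    have "\<phi> t + q t = w t + \<psi> t" by (simp add: w_def q_def)
    then have "H t (\<phi> t) + H t (q t) = H t (w t) + H t (\<psi> t)"
      using lin[OF t] phiX[OF t] qX[OF t] wX[OF t] psi(2)[OF t] unfolding clinear_on_def by metis
    then have H: "H t (\<phi> t) - H t (\<psi> t) = H t (w t) - H t (q t)" by (simp add: algebra_simps)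
    have "\<i> *\<^sub>C (d1 - P d2) = P (H t (\<phi> t)) - P (\<i> *\<^sub>C d2)"
      using spectral_proj_scaleC[OF pos, of N \<i> d2] d1(2) by (simp add: scaleC_diff_right P_def)
    also have "\<dots> = P (H t (w t) - H t (q t))" by (simp add: d2(2) H P.diff[symmetric])
    finally have "\<i> * cinner (w t) (d1 - P d2) = cinner (w t) (P (H t (w t) - H t (q t)))"
      by (metis cinner_scaleC_right)
    also have "\<dots> = cinner (w t) (H t (w t)) - cinner (w t) (H t (q t))"
      using spectral_proj_symmetric[OF pos, of N "w t" "H t (w t) - H t (q t)"] Pw[OF t]
      by (simp add: P_def cinner_diff_right)
    \<comment> \<open>Comparison of imaginary parts: multiplication by \<open>\<i>\<close> turns
      \<open>Re\<close> into \<open>Im\<close>, and the form at \<open>w t\<close> contributes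
      nothing.\<close>
    finally have "Re (cinner (w t) (d1 - P d2)) = - Im (cinner (w t) (H t (q t)))"
      using real[OF ab t wX[OF t]] by (simp add: complex_eq_iff)
    also have "\<bar>\<dots>\<bar> \<le> cmod (cinner (w t) (H t (q t)))" using abs_Im_le_cmod by simp
    also have "\<dots> \<le> norm (w t) * norm (H t (q t))" by (rule cinner_Cauchy_Schwarz)
    also have "\<dots> \<le> norm (w t) * (C * \<delta>)"
      using C(2)[OF t qX[OF t]] \<delta>[OF t] C(1) unfolding q_def
      by (intro mult_left_mono) (auto intro: order_trans mult_left_mono)
    finally show ?thesis using dw by (auto simp: mult.commute)
  qed
  then obtain d where d: "\<And>t. a < b \<Longrightarrow> t \<in> {a..b} \<Longrightarrow> (w has_vector_derivative d t) (at t within {a..b})"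
      "\<And>t. a < b \<Longrightarrow> t \<in> {a..b} \<Longrightarrow> \<bar>Re (cinner (w t) (d t))\<bar> \<le> C * \<delta> * norm (w t)"
    by metis
  have \<delta>0: "0 \<le> \<delta>" using \<delta>[OF t] scale_norm_nonneg order_trans by blast
  have "norm (w t) \<le> 2 * (C * \<delta>) * (b - a)"
  \<comment> \<open>Reality of the form is available only on a nondegenerate interval; on a single
    point, \<open>w\<close> is zero by the initial condition.\<close>
  proof (cases "a < b")
    case True
    show ?thesis
      by (rule norm_bound_from_energy[OF d[OF True]]) (use C \<delta>0 init t in \<open>auto simp: w_def\<close>)
  next
    case False
    then have "t = s" "a = b" using t init by auto
    then show ?thesis using init by (simp add: w_def)
  qed
  \<comment> \<open>Source of the \<open>+ 1\<close> in the constant: the discarded part itself,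
    whose plain norm is below its scale norm.\<close>
  moreover have "norm (q t) \<le> \<delta>"
    using norm_le_scale_norm[OF pos r qX[OF t]] \<delta>[OF t] by (simp add: q_def)
  moreover have "norm (\<phi> t - \<psi> t) \<le> norm (w t) + norm (q t)"
    using norm_triangle_ineq4[of "w t" "q t"] by (simp add: w_def q_def)
  ultimately show ?thesis by (simp add: algebra_simps)
qed

end

theorem theorem3p8:
  fixes D0 :: "'a::{complex_hilbert, second_countable_topology} set"
    and H0 :: "'a \<Rightarrow> 'a"
    and I :: "real set"
    and a b \<mu> :: real
    and DH :: "real \<Rightarrow> 'a set"
    and H Hext :: "real \<Rightarrow> 'a \<Rightarrow> 'a"
    and U :: "real \<Rightarrow> real \<Rightarrow> 'a \<Rightarrow> 'a"
    and U_N :: "real \<Rightarrow> real \<Rightarrow> real \<Rightarrow> 'a \<Rightarrow> 'a"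
    and u :: 'a
  assumes H0: "positive_op_compact_resolvent D0 H0"
    and I: "I = {a..b}" "a \<le> b"
    and mu: "\<mu> \<ge> 0"
    and symmetric: "\<And>t. t \<in> I \<Longrightarrow> symmetric_op (DH t) (H t)"
    and extends: "\<And>t v. t \<in> I \<Longrightarrow> v \<in> DH t \<inter> scale_space D0 H0 \<mu> \<Longrightarrow> Hext t v = H t v"
    and bounded: "\<And>t. t \<in> I \<Longrightarrow> bounded_from_scale D0 H0 \<mu> (Hext t)"
    and continuous: "\<And>t. t \<in> I \<Longrightarrow>
      ((\<lambda>t'. scale_opnorm D0 H0 \<mu> (\<lambda>v. Hext t' v - Hext t v)) \<longlongrightarrow> 0) (at t within I)"
    and propagator: "unitary_propagator I U"
    and preserves: "\<And>t s. t \<in> I \<Longrightarrow> s \<in> I \<Longrightarrow>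
      U t s ` scale_space D0 H0 \<mu> \<subseteq> scale_space D0 H0 \<mu>"
    and scale_continuous: "\<And>v t s. v \<in> scale_space D0 H0 \<mu> \<Longrightarrow> t \<in> I \<Longrightarrow> s \<in> I \<Longrightarrow>
      ((\<lambda>(t', s'). scale_norm D0 H0 \<mu> (U t' s' v - U t s v)) \<longlongrightarrow> 0) (at (t, s) within (I \<times> I))"
    and strong_solution: "\<And>v s. v \<in> scale_space D0 H0 \<mu> \<Longrightarrow> s \<in> I \<Longrightarrow>
      schroedinger_solution I Hext (\<lambda>t. U t s v)"
    and galerkin: "\<And>N. N > 0 \<Longrightarrow> galerkin_propagator D0 H0 I Hext N (U_N N)"
    and u: "u \<in> scale_space D0 H0 \<mu>"
  shows "((\<lambda>N. SUP (t, s)\<in>I \<times> I. norm (U_N N t s (spectral_proj D0 H0 N u) - U t s u))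
           \<longlongrightarrow> 0) at_top"
proof (rule tendstoI)
  fix e :: real assume e: "e > 0"
  let ?P = "spectral_proj D0 H0"
  obtain C where C: "0 \<le> C" "\<And>t v. t \<in> I \<Longrightarrow> v \<in> scale_space D0 H0 \<mu> \<Longrightarrow>
      norm (Hext t v) \<le> C * scale_norm D0 H0 \<mu> v"
    using continuous_opnorm_imp_uniform_bound[OF H0 mu _ bounded continuous] I(1) by (metis compact_Icc)
  \<comment> \<open>Tuned so that the error bound equals \<open>e / 2\<close>; the half is kept
    because a supremum preserves only non-strict bounds. Neither \<open>C\<close> nor \<delta>
    depends on \<open>N\<close>.\<close>
  define \<delta> where "\<delta> = e / 2 / (2 * C * (b - a) + 1)"
  have c0: "0 < 2 * C * (b - a) + 1" using C(1) I(2) by (simp add: add_nonneg_pos)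
  have UX: "U t s u \<in> scale_space D0 H0 \<mu>" if "t \<in> I" "s \<in> I" for t s
    using preserves[OF that] u by blast
  have "\<forall>\<^sub>F N in at_top. \<forall>x\<in>I \<times> I. scale_norm D0 H0 \<mu>
      ((case x of (t, s) \<Rightarrow> U t s u) - ?P N (case x of (t, s) \<Rightarrow> U t s u)) < \<delta>"
  proof (rule spectral_proj_tendsto_uniform[OF H0 mu])
    show "compact (I \<times> I)" unfolding I(1) by (intro compact_Times compact_Icc)
    show "0 < \<delta>" using e c0 by (simp add: \<delta>_def)
    fix x assume x: "x \<in> I \<times> I"
    show "(case x of (t, s) \<Rightarrow> U t s u) \<in> scale_space D0 H0 \<mu>" using x UX by auto
    show "((\<lambda>y. scale_norm D0 H0 \<mu> ((case y of (t, s) \<Rightarrow> U t s u) - (case x of (t, s) \<Rightarrow> U t s u)))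
        \<longlongrightarrow> 0) (at x within I \<times> I)"
      using x scale_continuous[OF u, of "fst x" "snd x"] by (auto simp: case_prod_unfold)
  qed
  then show "\<forall>\<^sub>F N in at_top.
      dist (SUP (t, s)\<in>I \<times> I. norm (U_N N t s (?P N u) - U t s u)) 0 < e"
    using eventually_gt_at_top[of 0]
  proof eventually_elim
    case (elim N)
    have bound: "norm (U_N N t s (?P N u) - U t s u) \<le> e / 2" if t: "t \<in> I" and s: "s \<in> I" for t s
    proof -
      have gal: "U_N N t s (?P N u) \<in> range (?P N)" if "t \<in> I" for t
        using galerkin[OF elim(2)] that s unfolding galerkin_propagator_def by blast
      have "norm (U_N N t s (?P N u) - U t s u) \<le> (2 * C * (b - a) + 1) * \<delta>"
      proof (rule galerkin_error_bound[OF H0 mu, where H = Hext and s = s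
            and \<phi> = "\<lambda>t. U_N N t s (?P N u)" and \<psi> = "\<lambda>t. U t s u"])
        show "schroedinger_solution {a..b} (galerkin_hamiltonian D0 H0 Hext N) (\<lambda>t. U_N N t s (?P N u))"
          using galerkin[OF elim(2)] s unfolding galerkin_propagator_def I(1) by blast
        show "schroedinger_solution {a..b} Hext (\<lambda>t. U t s u)"
          using strong_solution[OF u s] by (simp add: I(1))
        show "U_N N s s (?P N u) = ?P N (U s s u)"
          using galerkin[OF elim(2)] propagator s
          unfolding galerkin_propagator_def unitary_propagator_def by auto
        show "clinear_on (scale_space D0 H0 \<mu>) (Hext t)" if "t \<in> {a..b}" for t
          using bounded that by (simp add: I(1) bounded_from_scale_def)
        show "Im (cinner v (Hext t v)) = 0"
          if "a < b" "t \<in> {a..b}" "v \<in> scale_space D0 H0 \<mu>" for t v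
          using generator_form_real[OF H0 mu, of a b t U Hext v] propagator strong_solution[of v t] that
          by (simp add: I(1))
        show "norm (Hext t v) \<le> C * scale_norm D0 H0 \<mu> v"
          if "t \<in> {a..b}" "v \<in> scale_space D0 H0 \<mu>" for t v using C(2) that by (simp add: I(1))
        show "scale_norm D0 H0 \<mu> (U t s u - ?P N (U t s u)) \<le> \<delta>" if "t \<in> {a..b}" for t
          using elim(1) that s by (force simp: I(1))
      qed (use gal UX s t C(1) in \<open>auto simp: I(1)\<close>)
      also have "\<dots> = e / 2" using c0 unfolding \<delta>_def
        by (metis less_irrefl nonzero_mult_div_cancel_left times_divide_eq_right)
      finally show ?thesis .
    qed
    have ne: "(a, a) \<in> I \<times> I" using I by simp
    have "(SUP (t, s)\<in>I \<times> I. norm (U_N N t s (?P N u) - U t s u)) \<le> e / 2"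
      using ne bound by (intro cSUP_least) auto
    \<comment> \<open>The distance to 0 is an absolute value, so a lower bound is needed too; it
      takes a point of the index set and boundedness above.\<close>
    moreover have "0 \<le> (SUP (t, s)\<in>I \<times> I. norm (U_N N t s (?P N u) - U t s u))"
      using ne bound by (intro cSUP_upper2[of _ _ "(a, a)"] bdd_aboveI[of _ "e / 2"]) auto
    ultimately show ?case using e by simp
  qed
qed

end
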